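(* Let $n\ge 2$ and let $\Omega_p\subset\mathbb{C}^n$ be a domain of the class $\Omega^{(n)}$. Let $S=(S_1,\ldots,S_n)\in\mathcal{B}(\mathcal{H})^n$ and $T=(T_1,\ldots,T_n)\in\mathcal{B}(\mathcal{K})^n$ be $\partial\Omega_p$-isometries, and let $M=(M_1,\ldots,M_n)\in\mathcal{B}(\tilde{\mathcal{H}})^n$ and $N=(N_1,\ldots,N_n)\in\mathcal{B}(\tilde{\mathcal{K}})^n$ be the minimal normal extensions of $S$ and $T$, respectively. If $X:\mathcal{H}\to\mathcal{K}$ is a bounded linear map intertwining $S$ and $T$, so that $XS_i=T_iX$ for all $i$, then $X$ lifts to a bounded linear map $\tilde X:\tilde{\mathcal{H}}\to\tilde{\mathcal{K}}$ (that is, $\tilde X|_{\mathcal{H}}=X$) intertwining $M$ and $N$ (that is, $\tilde XM_i=N_i\tilde X$ for all $i$) and satisfying $\|\tilde X\|=\|X\|$.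
   Context: Class $\Omega^{(n)}$ ($n\ge 2$): let $p=(p_1,\ldots,p_n)$, where for each $1\le i\le n$, $p_i=(p_{i,1},\ldots,p_{i,m_i})$ is an $m_i$-tuple of positive integers with $m_i\ge 2$ and $\gcd\{p_{i,1},\ldots,p_{i,m_i}\}=1$. Put $\Omega_p=\{z\in\mathbb{C}^n:\sum_{i=1}^n\sum_{j=1}^{m_i}|z_i|^{2p_{i,j}}<1\}$, with topological boundary $\partial\Omega_p$ (defined by $=1$). $\Omega^{(n)}$ is the class of all such $\Omega_p$. $\mathcal{H}$ and $\mathcal{K}$ are complex infinite-dimensional separable Hilbert spaces; $\mathcal{B}(\cdot)$ denotes the algebra of bounded linear operators. An $n$-tuple $S=(S_1,\ldots,S_n)$ of commuting operators in $\mathcal{B}(\mathcal{H})$ is subnormal if there is an $n$-tuple of commuting normal operators $N_i$ on a Hilbert space containing $\mathcal{H}$ with $N_i\mathcal{H}\subset\mathcal{H}$ and $N_i|_{\mathcal{H}}=S_i$ for $1\le i\le n$. A subnormal tuple has a minimal normal extension, unique up to unitary equivalence. A $\partial\Omega_p$-isometry is a subnormal $n$-tuple whose minimal normal extension has its (joint) spectral measure supported on $\partial\Omega_p$. *)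

theory Defs
  imports "HOL-Analysis.Analysis"
begin

section \<open>Complex Hilbert spaces\<close>

text \<open>
  The inner product is linear in the first argument. Building on real normed vector spaces makes the
  library notions of topology, completeness, bounded linear map and operator norm available. The last
  axiom says both that the inner product is positive definite and that it induces the norm.
\<close>

class complex_inner = real_normed_vector +
  fixes scaleC :: "complex \<Rightarrow> 'a \<Rightarrow> 'a"  (infixr \<open>*\<^sub>C\<close> 75)
    and cinner :: "'a \<Rightarrow> 'a \<Rightarrow> complex"
  assumes scaleC_add_right: "a *\<^sub>C (x + y) = a *\<^sub>C x + a *\<^sub>C y"
    and scaleC_add_left: "(a + b) *\<^sub>C x = a *\<^sub>C x + b *\<^sub>C x"
    and scaleC_scaleC: "a *\<^sub>C b *\<^sub>C x = (a * b) *\<^sub>C x"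
    and scaleC_of_real: "complex_of_real r *\<^sub>C x = scaleR r x"
    and cinner_commute: "cinner x y = cnj (cinner y x)"
    and cinner_add_left: "cinner (x + y) z = cinner x z + cinner y z"
    and cinner_scaleC_left: "cinner (a *\<^sub>C x) y = a * cinner x y"
    and cinner_self: "cinner x x = complex_of_real ((norm x)\<^sup>2)"

class chilbert_space = complex_inner + complete_space

lemma scaleC_one: "1 *\<^sub>C x = (x :: 'a :: complex_inner)"
  using scaleC_of_real[of 1 x] by simp

global_interpretation cvector: vector_space "scaleC :: complex \<Rightarrow> 'a \<Rightarrow> 'a :: complex_inner"
  by unfold_locales (simp_all add: scaleC_add_right scaleC_add_left scaleC_scaleC scaleC_one)

definition separable_infinite_dimensional :: "'a :: complex_inner itself \<Rightarrow> bool" where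
  "separable_infinite_dimensional _ \<longleftrightarrow>
     (\<exists>D :: 'a set. countable D \<and> closure D = UNIV) \<and>
     \<not> (\<exists>B :: 'a set. finite B \<and> cvector.span B = UNIV)"


section \<open>Bounded operators\<close>

definition bounded_clinear :: "('a :: complex_inner \<Rightarrow> 'b :: complex_inner) \<Rightarrow> bool" where
  "bounded_clinear f \<longleftrightarrow> bounded_linear f \<and> (\<forall>c x. f (c *\<^sub>C x) = c *\<^sub>C f x)"

text \<open>The Hilbert space adjoint; it exists uniquely for bounded operators (Riesz).\<close>

definition cadjoint :: "('a :: chilbert_space \<Rightarrow> 'b :: chilbert_space) \<Rightarrow> 'b \<Rightarrow> 'a" where
  "cadjoint f = (THE g. \<forall>x y. cinner (f x) y = cinner x (g y))"

definition normal_operator :: "('a :: chilbert_space \<Rightarrow> 'a) \<Rightarrow> bool" where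
  "normal_operator f \<longleftrightarrow> bounded_clinear f \<and> f \<circ> cadjoint f = cadjoint f \<circ> f"

definition orthogonal_projection :: "('a :: chilbert_space \<Rightarrow> 'a) \<Rightarrow> bool" where
  "orthogonal_projection P \<longleftrightarrow> bounded_clinear P \<and> P \<circ> P = P \<and> cadjoint P = P"

definition commuting_tuple :: "('n :: finite \<Rightarrow> 'a :: complex_inner \<Rightarrow> 'a) \<Rightarrow> bool" where
  "commuting_tuple S \<longleftrightarrow> (\<forall>i. bounded_clinear (S i)) \<and> (\<forall>i j. S i \<circ> S j = S j \<circ> S i)"


section \<open>Subnormal tuples and minimal normal extensions\<close>

text \<open>
  The inclusion of a Hilbert space in a larger one is a linear isometry \<open>J\<close> between types. The
  intertwining relation below contains the invariance of the range of \<open>J\<close> under each \<open>N i\<close>.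
\<close>

definition normal_extension ::
    "('n :: finite \<Rightarrow> 'h :: chilbert_space \<Rightarrow> 'h) \<Rightarrow> ('h \<Rightarrow> 'k :: chilbert_space) \<Rightarrow>
     ('n \<Rightarrow> 'k \<Rightarrow> 'k) \<Rightarrow> bool" where
  "normal_extension S J N \<longleftrightarrow>
     bounded_clinear J \<and> (\<forall>x. norm (J x) = norm x) \<and>
     commuting_tuple N \<and> (\<forall>i. normal_operator (N i)) \<and>
     (\<forall>i x. N i (J x) = J (S i x))"

definition reducing_subspace ::
    "('n :: finite \<Rightarrow> 'k :: chilbert_space \<Rightarrow> 'k) \<Rightarrow> 'k set \<Rightarrow> bool" where
  "reducing_subspace N L \<longleftrightarrow>
     cvector.subspace L \<and> closed L \<and>
     (\<forall>i. \<forall>x\<in>L. N i x \<in> L \<and> cadjoint (N i) x \<in> L)"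

definition minimal_normal_extension ::
    "('n :: finite \<Rightarrow> 'h :: chilbert_space \<Rightarrow> 'h) \<Rightarrow> ('h \<Rightarrow> 'k :: chilbert_space) \<Rightarrow>
     ('n \<Rightarrow> 'k \<Rightarrow> 'k) \<Rightarrow> bool" where
  "minimal_normal_extension S J N \<longleftrightarrow>
     normal_extension S J N \<and>
     (\<forall>L. reducing_subspace N L \<and> range J \<subseteq> L \<longrightarrow> L = UNIV)"

text \<open>
  Types cannot be quantified existentially, so the type of the space carrying the extension is a
  parameter.
\<close>

definition subnormal_tuple ::
    "'k :: chilbert_space itself \<Rightarrow> ('n :: finite \<Rightarrow> 'h :: chilbert_space \<Rightarrow> 'h) \<Rightarrow> bool" where
  "subnormal_tuple _ S \<longleftrightarrow>
     commuting_tuple S \<and> (\<exists>(J :: 'h \<Rightarrow> 'k) N. normal_extension S J N)"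


section \<open>Joint spectral measures\<close>

definition spectral_measure ::
    "((complex ^ 'n) set \<Rightarrow> 'k :: chilbert_space \<Rightarrow> 'k) \<Rightarrow> bool" where
  "spectral_measure E \<longleftrightarrow>
     (\<forall>A\<in>sets borel. orthogonal_projection (E A)) \<and>
     E {} = (\<lambda>_. 0) \<and> E UNIV = id \<and>
     (\<forall>A\<in>sets borel. \<forall>B\<in>sets borel. E (A \<inter> B) = E A \<circ> E B) \<and>
     (\<forall>A :: nat \<Rightarrow> (complex ^ 'n) set. range A \<subseteq> sets borel \<and> disjoint_family A \<longrightarrow>
        (\<forall>x. (\<lambda>k. E (A k) x) sums E (\<Union>k. A k) x))"

text \<open>The positive Borel measure sending \<open>A\<close> to the inner product of \<open>E A x\<close> with \<open>x\<close>.\<close>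

definition scalar_spectral_measure ::
    "((complex ^ 'n) set \<Rightarrow> 'k :: chilbert_space \<Rightarrow> 'k) \<Rightarrow> 'k \<Rightarrow> (complex ^ 'n) measure" where
  "scalar_spectral_measure E x =
     measure_of UNIV (sets borel) (\<lambda>A. ennreal (Re (cinner (E A x) x)))"

text \<open>
  \<open>N i\<close> is the integral of the i-th coordinate function against \<open>E\<close>, in the weak sense; on a complex
  space it is enough to test on the diagonal. By the spectral theorem every tuple of commuting normal
  operators has exactly one such \<open>E\<close>.
\<close>

definition joint_spectral_measure ::
    "('n :: finite \<Rightarrow> 'k :: chilbert_space \<Rightarrow> 'k) \<Rightarrow> ((complex ^ 'n) set \<Rightarrow> 'k \<Rightarrow> 'k) \<Rightarrow> bool" where
  "joint_spectral_measure N E \<longleftrightarrow>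
     spectral_measure E \<and>
     (\<forall>i x. has_bochner_integral (scalar_spectral_measure E x) (\<lambda>z. z $ i) (cinner (N i x) x))"

definition joint_spectral_measure_on ::
    "('n :: finite \<Rightarrow> 'k :: chilbert_space \<Rightarrow> 'k) \<Rightarrow> (complex ^ 'n) set \<Rightarrow> bool" where
  "joint_spectral_measure_on N C \<longleftrightarrow>
     (\<exists>E. joint_spectral_measure N E \<and> E (- C) = (\<lambda>_. 0))"


section \<open>The domains and the isometries attached to them\<close>

text \<open>The tuple of exponents belonging to the i-th coordinate is the list \<open>p i\<close>.\<close>

definition admissible_exponents :: "('n :: finite \<Rightarrow> nat list) \<Rightarrow> bool" where
  "admissible_exponents p \<longleftrightarrow>
     (\<forall>i. length (p i) \<ge> 2 \<and> (\<forall>q\<in>set (p i). q > 0) \<and> Gcd (set (p i)) = 1)"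

definition Omega :: "('n :: finite \<Rightarrow> nat list) \<Rightarrow> (complex ^ 'n) set" where
  "Omega p = {z. (\<Sum>i\<in>UNIV. \<Sum>j<length (p i). norm (z $ i) ^ (2 * p i ! j)) < 1}"

lemma frontier_Omega:
  fixes p :: "'n :: finite \<Rightarrow> nat list"
  assumes "admissible_exponents p"
  shows "frontier (Omega p) =
    {z. (\<Sum>i\<in>UNIV. \<Sum>j<length (p i). norm (z $ i) ^ (2 * p i ! j)) = 1}"
proof -
  define f :: "complex ^ 'n \<Rightarrow> real"
    where "f = (\<lambda>z. \<Sum>i\<in>UNIV. \<Sum>j<length (p i). norm (z $ i) ^ (2 * p i ! j))"
  have Om: "Omega p = {z. f z < 1}" by (simp add: Omega_def f_def)
  have cont: "continuous_on UNIV f" unfolding f_def by (intro continuous_intros)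
  have op: "open (Omega p)" unfolding Om
    using open_Collect_less[OF cont continuous_on_const[of UNIV 1]] by simp
  have cl: "closed {z. f z \<le> 1}"
    using closed_Collect_le[OF cont continuous_on_const[of UNIV 1]] by simp
  have sub: "closure (Omega p) \<subseteq> {z. f z \<le> 1}"
    by (rule closure_minimal[OF _ cl]) (auto simp: Om)
  have bd: "z \<in> closure (Omega p)" if z: "f z = 1" for z
  proof -
    have scaled: "t *\<^sub>R z \<in> Omega p" if t: "0 \<le> t" "t < 1" for t
    proof -
      have "f (t *\<^sub>R z) \<le> t * f z"
        unfolding f_def sum_distrib_left
      proof (intro sum_mono)
        fix i j assume "j \<in> {..<length (p i)}"
        then have "0 < p i ! j"
          using assms unfolding admissible_exponents_def by (meson lessThan_iff nth_mem)
        then have "t ^ (2 * p i ! j) \<le> t ^ 1"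
          using t by (intro power_decreasing) auto
        then show "norm ((t *\<^sub>R z) $ i) ^ (2 * p i ! j) \<le> t * norm (z $ i) ^ (2 * p i ! j)"
          using t by (simp add: power_mult_distrib mult_right_mono)
      qed
      then show ?thesis using z t by (simp add: Om)
    qed
    define t :: "nat \<Rightarrow> real" where "t k = 1 - 1 / real (Suc k)" for k
    have "t \<longlonglongrightarrow> 1 - 0"
      unfolding t_def using LIMSEQ_inverse_real_of_nat
      by (intro tendsto_diff tendsto_const) (simp add: inverse_eq_divide)
    then have "(\<lambda>k. t k *\<^sub>R z) \<longlonglongrightarrow> 1 *\<^sub>R z" by (intro tendsto_intros) simp
    moreover have "t k *\<^sub>R z \<in> Omega p" for k by (rule scaled) (auto simp: t_def field_simps)
    ultimately show ?thesis unfolding closure_sequential by (intro exI[of _ "\<lambda>k. t k *\<^sub>R z"]) simp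
  qed
  have "frontier (Omega p) = closure (Omega p) - Omega p"
    using op by (simp add: frontier_def interior_open)
  also have "\<dots> = {z. f z = 1}" using sub bd by (force simp: Om)
  finally show ?thesis by (simp add: f_def)
qed

text \<open>
  A minimal normal extension is unique up to unitary equivalence, so the support condition does not
  depend on the choice of the extension; the second conjunct ensures that the type \<open>'k\<close> carries one.
\<close>

definition boundary_isometry ::
    "'k :: chilbert_space itself \<Rightarrow> ('n :: finite \<Rightarrow> nat list) \<Rightarrow>
     ('n \<Rightarrow> 'h :: chilbert_space \<Rightarrow> 'h) \<Rightarrow> bool" where
  "boundary_isometry k p S \<longleftrightarrow>
     subnormal_tuple k S \<and>
     (\<exists>(J :: 'h \<Rightarrow> 'k) N. minimal_normal_extension S J N) \<and>
     (\<forall>(J :: 'h \<Rightarrow> 'k) N. minimal_normal_extension S J N \<longrightarrow>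
        joint_spectral_measure_on N (frontier (Omega p)))"

end

theory Submission
  imports Defs
begin

text \<open>
  The operators \<open>V\<^sub>c = S\<^sub>i\<^sup>q\<close>, where \<open>c\<close> runs over the pairs of an index \<open>i\<close> and a position \<open>j\<close> in
  the list \<open>p i\<close> and \<open>q\<close> is the exponent \<open>p i ! j\<close>, form a spherical isometry because the spectral
  measure of \<open>M\<close> lives on the boundary. The form \<open>\<parallel>X\<parallel>\<^sup>2 \<langle>x, y\<rangle> - \<langle>X x, X y\<rangle>\<close> is positive, and the \<open>V\<^sub>c\<close>
  are a spherical isometry for it as well; spherical isometries satisfy the positivity condition of
  Bram, Halmos and Ito, and for this form the condition says that sending the sum of the \<open>V\<^sub>w\<^sup>* Z\<^sub>w\<close>
  over the words \<open>w\<close> of length \<open>d\<close> (adjoints in the extension \<open>M\<close>) to the sum of the \<open>V\<^sub>w\<^sup>* X Z\<^sub>w\<close>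
  (adjoints in \<open>N\<close>) is well defined with norm at most \<open>\<parallel>X\<parallel>\<close>. Such sums are dense: their closure is
  invariant under \<open>M\<^sub>i\<close> and under the powers of \<open>M\<^sub>i\<^sup>*\<close> with exponents in \<open>p i\<close>, and since these
  exponents are coprime, it reduces \<open>M\<^sub>i\<close>.
\<close>

section \<open>Hilbert space preliminaries\<close>

lemma cinner_add_right: "cinner x (y + z) = cinner x y + cinner x (z :: 'a :: complex_inner)"
  by (metis cinner_add_left cinner_commute complex_cnj_add)

lemma cinner_scaleC_right: "cinner x (a *\<^sub>C y) = cnj a * cinner x (y :: 'a :: complex_inner)"
  by (metis cinner_scaleC_left cinner_commute complex_cnj_mult)

lemma cinner_zero_left [simp]: "cinner 0 (y :: 'a :: complex_inner) = 0"
  using cinner_add_left[of 0 0 y] by simp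

lemma cinner_zero_right [simp]: "cinner (y :: 'a :: complex_inner) 0 = 0"
  using cinner_add_right[of y 0 0] by simp

lemma cinner_minus_left: "cinner (- x) y = - cinner x (y :: 'a :: complex_inner)"
  using cinner_add_left[of x "- x" y] by (simp add: add_eq_0_iff)

lemma cinner_minus_right: "cinner x (- y) = - cinner x (y :: 'a :: complex_inner)"
  using cinner_add_right[of x y "- y"] by (simp add: add_eq_0_iff)

lemma cinner_diff_left: "cinner (x - y) z = cinner x z - cinner y (z :: 'a :: complex_inner)"
  using cinner_add_left[of x "- y" z] by (simp add: cinner_minus_left)

lemma cinner_diff_right: "cinner z (x - y) = cinner z x - cinner z (y :: 'a :: complex_inner)"
  using cinner_add_right[of z x "- y"] by (simp add: cinner_minus_right)

lemma cinner_sum_left: "cinner (sum f A) y = (\<Sum>a\<in>A. cinner (f a) (y :: 'a :: complex_inner))"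
  by (induction A rule: infinite_finite_induct) (auto simp: cinner_add_left)

lemma cinner_sum_right: "cinner y (sum f A) = (\<Sum>a\<in>A. cinner y (f a :: 'a :: complex_inner))"
  by (induction A rule: infinite_finite_induct) (auto simp: cinner_add_right)

lemmas cinner_simps = cinner_add_left cinner_add_right cinner_diff_left cinner_diff_right
  cinner_minus_left cinner_minus_right cinner_scaleC_left cinner_scaleC_right

lemma cinner_self_eq_0_iff: "cinner x x = 0 \<longleftrightarrow> x = (0 :: 'a :: complex_inner)"
  by (simp add: cinner_self)

lemma norm_sq_cinner: "(norm x)\<^sup>2 = Re (cinner x (x :: 'a :: complex_inner))"
  by (simp add: cinner_self)

lemma norm_scaleC: "norm (a *\<^sub>C x) = cmod a * norm (x :: 'a :: complex_inner)"
proof -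
  have "complex_of_real ((norm (a *\<^sub>C x))\<^sup>2) = a * cnj a * complex_of_real ((norm x)\<^sup>2)"
    unfolding cinner_self[symmetric] by (simp add: cinner_simps)
  also have "\<dots> = complex_of_real ((cmod a * norm x)\<^sup>2)"
    unfolding complex_norm_square[symmetric] by (simp add: power_mult_distrib)
  finally have "(norm (a *\<^sub>C x))\<^sup>2 = (cmod a * norm x)\<^sup>2" using of_real_eq_iff by blast
  then show ?thesis by simp
qed

lemma norm_add_sq:
  "(norm (x + y))\<^sup>2 = (norm x)\<^sup>2 + 2 * Re (cinner x y) + (norm (y :: 'a :: complex_inner))\<^sup>2"
proof -
  have "Re (cinner y x) = Re (cinner x y)" by (subst cinner_commute) simp
  then show ?thesis by (simp add: norm_sq_cinner cinner_simps)
qed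

lemma norm_diff_sq:
  "(norm (x - y))\<^sup>2 = (norm x)\<^sup>2 - 2 * Re (cinner x y) + (norm (y :: 'a :: complex_inner))\<^sup>2"
  using norm_add_sq[of x "- y"] by (simp add: cinner_simps)

lemma cinner_cauchy_schwarz: "cmod (cinner x y) \<le> norm x * norm (y :: 'a :: complex_inner)"
proof (cases "y = 0")
  case False
  define c where "c = cinner x y"
  define t where "t = (norm y)\<^sup>2"
  have t: "t > 0" using False by (simp add: t_def)
  have "0 \<le> (norm (x - (c / of_real t) *\<^sub>C y))\<^sup>2" by simp
  also have "\<dots> = (norm x)\<^sup>2 - 2 * (cmod c)\<^sup>2 / t + (cmod c / t)\<^sup>2 * t"
  proof -
    have "Re (cinner x ((c / of_real t) *\<^sub>C y)) = (cmod c)\<^sup>2 / t"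
    proof -
      have "cinner x ((c / of_real t) *\<^sub>C y) = c * cnj c / of_real t"
        by (simp add: cinner_simps c_def)
      also have "\<dots> = complex_of_real ((cmod c)\<^sup>2 / t)"
        by (simp add: complex_norm_square[symmetric])
      finally show ?thesis by (simp only: Re_complex_of_real)
    qed
    then show ?thesis using t
      by (simp add: norm_diff_sq norm_scaleC norm_divide power_mult_distrib power_divide t_def[symmetric])
  qed
  also have "\<dots> = (norm x)\<^sup>2 - (cmod c)\<^sup>2 / t"
    using t by (simp add: field_simps power2_eq_square)
  finally have "(cmod c)\<^sup>2 \<le> (norm x * norm y)\<^sup>2"
    using t by (simp add: field_simps t_def)
  then show ?thesis unfolding c_def by (rule power2_le_imp_le) simp
qed simp

lemma bounded_linear_cinner_left: "bounded_linear (\<lambda>x. cinner x (y :: 'a :: complex_inner))"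
proof (rule bounded_linear_intro[where K = "norm y"])
  show "cinner (r *\<^sub>R x) y = r *\<^sub>R cinner x y" for r x
    by (simp add: scaleC_of_real[symmetric] cinner_simps scaleR_conv_of_real)
qed (simp_all add: cinner_simps cinner_cauchy_schwarz)

text \<open>Two linear maps are allowed so that the identity serves both for forms
  \<open>cinner (F x) x\<close>, with \<open>g\<close> the identity, and for a single map in both
  places, such as an isometry.\<close>

lemma cinner_polarization:
  fixes x y :: "'a :: complex_inner" and f :: "'a \<Rightarrow> 'b :: complex_inner" and g :: "'a \<Rightarrow> 'b"
  assumes f: "\<And>x y. f (x + y) = f x + f y" "\<And>c x. f (c *\<^sub>C x) = c *\<^sub>C f x"
    and g: "\<And>x y. g (x + y) = g x + g y" "\<And>c x. g (c *\<^sub>C x) = c *\<^sub>C g x"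
  shows "4 * cinner (f x) (g y) =
     cinner (f (x + y)) (g (x + y)) - cinner (f (x + (-1) *\<^sub>C y)) (g (x + (-1) *\<^sub>C y))
     + \<i> * cinner (f (x + \<i> *\<^sub>C y)) (g (x + \<i> *\<^sub>C y))
     - \<i> * cinner (f (x + (-\<i>) *\<^sub>C y)) (g (x + (-\<i>) *\<^sub>C y))"
  by (simp only: f g cinner_simps) (simp add: algebra_simps)

section \<open>Bounded complex-linear maps\<close>

lemma bounded_clinearD:
  assumes "bounded_clinear f"
  shows "f (x + y) = f x + f y" "f (c *\<^sub>C x) = c *\<^sub>C f x" "f (x - y) = f x - f y" "f 0 = 0"
    "f (sum h A) = (\<Sum>a\<in>A. f (h a))"
proof -
  interpret bounded_linear f using assms by (simp add: bounded_clinear_def)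
  show "f (x + y) = f x + f y" "f (x - y) = f x - f y" "f 0 = 0" "f (sum h A) = (\<Sum>a\<in>A. f (h a))"
    by (simp_all add: add diff zero sum)
  show "f (c *\<^sub>C x) = c *\<^sub>C f x" using assms by (simp add: bounded_clinear_def)
qed

lemma bounded_clinear_bounded_linear: "bounded_clinear f \<Longrightarrow> bounded_linear f"
  by (simp add: bounded_clinear_def)

lemma bounded_clinear_id: "bounded_clinear (\<lambda>x. x)"
  by (simp add: bounded_clinear_def bounded_linear_ident)

lemma bounded_clinear_zero: "bounded_clinear (\<lambda>x. 0)"
  by (simp add: bounded_clinear_def)

lemma bounded_linear_scaleC: "bounded_linear (\<lambda>x. c *\<^sub>C (x :: 'a :: complex_inner))"
proof (rule bounded_linear_intro[where K = "cmod c"])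
  show "c *\<^sub>C r *\<^sub>R x = r *\<^sub>R c *\<^sub>C x" for r and x :: 'a
    by (simp add: scaleC_of_real[symmetric] scaleC_scaleC mult.commute)
qed (simp_all add: scaleC_add_right norm_scaleC)

lemma bounded_clinear_scaleC: "bounded_clinear f \<Longrightarrow> bounded_clinear (\<lambda>x. c *\<^sub>C f x)"
  using bounded_linear_compose[OF bounded_linear_scaleC, of f c]
  by (auto simp: bounded_clinear_def scaleC_scaleC mult.commute)

lemma bounded_clinear_add:
  "bounded_clinear f \<Longrightarrow> bounded_clinear g \<Longrightarrow> bounded_clinear (\<lambda>x. f x + g x)"
  by (simp add: bounded_clinear_def bounded_linear_add scaleC_add_right)

lemma bounded_clinear_compose:
  "bounded_clinear f \<Longrightarrow> bounded_clinear g \<Longrightarrow> bounded_clinear (f \<circ> g)"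
  using bounded_linear_compose[of f g] by (simp add: bounded_clinear_def o_def)

lemma bounded_clinear_funpow:
  fixes f :: "'a :: complex_inner \<Rightarrow> 'a"
  shows "bounded_clinear f \<Longrightarrow> bounded_clinear (f ^^ n)"
proof (induction n)
  case 0
  show ?case using bounded_clinear_id unfolding funpow.simps id_def .
qed (simp add: bounded_clinear_compose)

lemma bounded_clinear_LIMSEQ:
  "bounded_clinear f \<Longrightarrow> u \<longlonglongrightarrow> l \<Longrightarrow> (\<lambda>n. f (u n)) \<longlonglongrightarrow> f l"
  by (rule bounded_linear.tendsto[OF bounded_clinear_bounded_linear])

section \<open>Closed subspaces, nearest points and Riesz representation\<close>

lemma csubspaceD:
  assumes "cvector.subspace L"
  shows "0 \<in> L" "x \<in> L \<Longrightarrow> y \<in> L \<Longrightarrow> x + y \<in> L" "x \<in> L \<Longrightarrow> c *\<^sub>C x \<in> L"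
    "x \<in> L \<Longrightarrow> y \<in> L \<Longrightarrow> x - y \<in> L" "x \<in> L \<Longrightarrow> r *\<^sub>R x \<in> L"
  using assms cvector.subspace_0 cvector.subspace_add cvector.subspace_scale cvector.subspace_diff
  by (auto simp: scaleC_of_real[symmetric])

text \<open>A minimizing sequence for the distance from \<open>x\<close> to \<open>L\<close> is
  Cauchy by the parallelogram law; its limit \<open>v\<close> is a nearest point, which makes
  \<open>x - v\<close> orthogonal to \<open>L\<close>.\<close>

lemma orthogonal_decomposition:
  fixes L :: "'a :: chilbert_space set"
  assumes L: "cvector.subspace L" and cl: "closed L"
  obtains v where "v \<in> L" "\<And>l. l \<in> L \<Longrightarrow> cinner (x - v) l = 0"
proof -
  define D where "D = (\<lambda>l. (norm (x - l))\<^sup>2) ` L"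
  define d where "d = Inf D"
  have ne: "D \<noteq> {}" using csubspaceD(1)[OF L] by (auto simp: D_def)
  have bd: "bdd_below D" by (rule bdd_belowI[of _ 0]) (auto simp: D_def)
  have d_le: "d \<le> (norm (x - l))\<^sup>2" if "l \<in> L" for l
    unfolding d_def by (rule cInf_lower[OF _ bd]) (use that in \<open>auto simp: D_def\<close>)
  have "\<exists>l\<in>L. (norm (x - l))\<^sup>2 < d + 1 / real (Suc n)" for n
    using cInf_less_iff[OF ne bd, of "d + 1 / real (Suc n)"] by (auto simp: d_def D_def)
  then obtain u where u: "\<And>n. u n \<in> L" "\<And>n. (norm (x - u n))\<^sup>2 < d + 1 / real (Suc n)"
    by metis
  have par: "(norm (u m - u n))\<^sup>2 \<le> 2 / real (Suc m) + 2 / real (Suc n)" for m n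
  proof -
    define a b where "a = x - u m" and "b = x - u n"
    have "(norm (a - b))\<^sup>2 + (norm (a + b))\<^sup>2 = 2 * (norm a)\<^sup>2 + 2 * (norm b)\<^sup>2"
      by (simp add: norm_add_sq norm_diff_sq)
    \<comment> \<open>The midpoint of \<open>u m\<close> and \<open>u n\<close> lies in
      \<open>L\<close>, so its squared distance from \<open>x\<close> is at least
      \<open>d\<close>.\<close>
    moreover have "4 * d \<le> (norm (a + b))\<^sup>2"
    proof -
      have "a + b = 2 *\<^sub>R (x - (1/2) *\<^sub>R (u m + u n))"
        by (simp add: a_def b_def algebra_simps scaleR_2)
      moreover have "d \<le> (norm (x - (1/2) *\<^sub>R (u m + u n)))\<^sup>2"
        by (intro d_le csubspaceD[OF L] u)
      ultimately show ?thesis by (simp add: power_mult_distrib)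
    qed
    moreover have "(norm (a - b))\<^sup>2 = (norm (u m - u n))\<^sup>2"
      by (simp add: a_def b_def norm_minus_commute)
    ultimately show ?thesis using u(2)[of m] u(2)[of n] by (simp add: a_def b_def)
  qed
  have "Cauchy u"
  proof (rule metric_CauchyI)
    fix e :: real assume e: "e > 0"
    obtain M where M: "4 / e\<^sup>2 < real M" using reals_Archimedean2 by blast
    have "dist (u m) (u n) < e" if "m \<ge> M" "n \<ge> M" for m n
    proof -
      have *: "2 / real (Suc k) < e\<^sup>2 / 2" if "k \<ge> M" for k
      proof -
        have "4 / e\<^sup>2 < real (Suc k)" using M that by simp
        then show ?thesis using e by (simp add: field_simps)
      qed
      have "(norm (u m - u n))\<^sup>2 < e\<^sup>2" using par[of m n] *[OF that(1)] *[OF that(2)] by simp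
      then show ?thesis using e power2_less_imp_less by (fastforce simp: dist_norm)
    qed
    then show "\<exists>M. \<forall>m\<ge>M. \<forall>n\<ge>M. dist (u m) (u n) < e" by blast
  qed
  then obtain v where v: "u \<longlonglongrightarrow> v" using Cauchy_convergent convergent_def by blast
  have vL: "v \<in> L" using closed_sequentially[OF cl _ v] u(1) by blast
  have nv: "(norm (x - v))\<^sup>2 \<le> d"
  proof (rule LIMSEQ_le)
    show "(\<lambda>n. (norm (x - u n))\<^sup>2) \<longlonglongrightarrow> (norm (x - v))\<^sup>2" by (intro tendsto_intros v)
    show "(\<lambda>n. d + 1 / real (Suc n)) \<longlonglongrightarrow> d"
      using tendsto_add[OF tendsto_const[of d] LIMSEQ_inverse_real_of_nat]
      by (simp add: inverse_eq_divide)
  qed (use u(2) less_imp_le in blast)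
  have "cinner (x - v) l = 0" if l: "l \<in> L" for l
  proof (cases "l = 0")
    case False
    define c where "c = cinner (x - v) l"
    define t where "t = (norm l)\<^sup>2"
    have t: "t > 0" using False by (simp add: t_def)
    \<comment> \<open>The coefficient \<open>c / of_real t\<close> minimizes the distance from
      \<open>x\<close> along the line through \<open>v\<close> in direction \<open>l\<close>;
      minimality of \<open>v\<close> then forces \<open>c = 0\<close>.\<close>
    have "d \<le> (norm (x - (v + (c / of_real t) *\<^sub>C l)))\<^sup>2"
      by (intro d_le csubspaceD[OF L] vL l)
    also have "\<dots> = (norm (x - v - (c / of_real t) *\<^sub>C l))\<^sup>2" by (simp add: algebra_simps)
    also have "\<dots> = (norm (x - v))\<^sup>2 - 2 * (cmod c)\<^sup>2 / t + (cmod c / t)\<^sup>2 * t"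
    proof -
      have "cinner (x - v) ((c / of_real t) *\<^sub>C l) = c * cnj c / of_real t"
        by (simp add: cinner_scaleC_right c_def)
      also have "\<dots> = complex_of_real ((cmod c)\<^sup>2 / t)"
        by (simp add: complex_norm_square[symmetric])
      finally have "Re (cinner (x - v) ((c / of_real t) *\<^sub>C l)) = (cmod c)\<^sup>2 / t"
        by (simp only: Re_complex_of_real)
      then show ?thesis using t
        by (simp add: norm_diff_sq[of "x - v"] norm_scaleC norm_divide power_mult_distrib power_divide t_def[symmetric])
    qed
    also have "\<dots> = (norm (x - v))\<^sup>2 - (cmod c)\<^sup>2 / t"
      using t by (simp add: field_simps power2_eq_square)
    finally have "(cmod c)\<^sup>2 / t \<le> 0" using nv by simp
    then show ?thesis using t by (simp add: divide_le_0_iff c_def)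
  qed simp
  then show ?thesis using that vL by blast
qed

text \<open>A nonzero vector \<open>u\<close> orthogonal to the kernel determines the functional,
  because \<open>\<phi> x *\<^sub>C u - \<phi> u *\<^sub>C x\<close> always lies in the kernel and
  is therefore orthogonal to \<open>u\<close>.\<close>

lemma riesz_representation:
  fixes \<phi> :: "'a :: chilbert_space \<Rightarrow> complex"
  assumes lin: "bounded_linear \<phi>" and cl: "\<And>c x. \<phi> (c *\<^sub>C x) = c * \<phi> x"
  obtains g where "\<And>x. \<phi> x = cinner x g"
proof (cases "\<forall>x. \<phi> x = 0")
  case True
  then show ?thesis using that[of 0] by simp
next
  case False
  then obtain x0 where x0: "\<phi> x0 \<noteq> 0" by blast
  interpret bounded_linear \<phi> by (rule lin)
  define L where "L = {x. \<phi> x = 0}"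
  have "cvector.subspace L" by (auto simp: cvector.subspace_def L_def zero add cl)
  moreover have "closed L" unfolding L_def
    by (intro closed_Collect_eq continuous_intros linear_continuous_on lin)
  ultimately obtain v where v: "v \<in> L" "\<And>l. l \<in> L \<Longrightarrow> cinner (x0 - v) l = 0"
    using orthogonal_decomposition by blast
  define u where "u = x0 - v"
  have fu: "\<phi> u \<noteq> 0" using x0 v(1) by (simp add: u_def diff L_def)
  then have u0: "u \<noteq> 0" using zero by auto
  have "\<phi> x = cinner x (cnj (\<phi> u / cinner u u) *\<^sub>C u)" for x
  proof -
    have "\<phi> x *\<^sub>C u - \<phi> u *\<^sub>C x \<in> L" by (simp add: L_def diff cl)
    then have "cinner u (\<phi> x *\<^sub>C u - \<phi> u *\<^sub>C x) = 0" using v(2) by (simp add: u_def)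
    then have "cinner (\<phi> x *\<^sub>C u - \<phi> u *\<^sub>C x) u = 0" by (subst cinner_commute) simp
    then show ?thesis using u0 by (simp add: cinner_simps cinner_self_eq_0_iff field_simps)
  qed
  then show ?thesis using that by blast
qed

section \<open>Adjoints and normal operators\<close>

lemma cinner_eqI:
  assumes "\<And>z. cinner z x = cinner z (y :: 'a :: complex_inner)"
  shows "x = y"
  using assms[of "x - y"] cinner_self_eq_0_iff[of "x - y"] by (simp add: cinner_diff_right)

text \<open>The definite description in \<open>cadjoint\<close> has a witness by Riesz
  representation, and only one because a vector is determined by its inner products.\<close>

lemma cinner_cadjoint:
  fixes f :: "'a :: chilbert_space \<Rightarrow> 'b :: chilbert_space"
  assumes f: "bounded_clinear f"
  shows "cinner (f x) y = cinner x (cadjoint f y)"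
proof -
  have "\<exists>g. \<forall>x. cinner (f x) y = cinner x g" for y
  proof -
    have "bounded_linear (\<lambda>x. cinner (f x) y)"
      by (rule bounded_linear_compose[OF bounded_linear_cinner_left
            bounded_clinear_bounded_linear[OF f]])
    then obtain g where "\<And>x. cinner (f x) y = cinner x g"
      by (rule riesz_representation) (auto simp: bounded_clinearD[OF f] cinner_simps)
    then show ?thesis by blast
  qed
  then obtain g where g: "\<forall>x y. cinner (f x) y = cinner x (g y)" by metis
  have "\<forall>x y. cinner (f x) y = cinner x (cadjoint f y)"
    unfolding cadjoint_def
  proof (rule theI[where a = g])
    show "h = g" if "\<forall>x y. cinner (f x) y = cinner x (h y)" for h
      using that g by (intro ext cinner_eqI) metis
  qed (rule g)
  then show ?thesis by blast
qed

lemma cinner_cadjoint':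
  fixes f :: "'a :: chilbert_space \<Rightarrow> 'b :: chilbert_space"
  assumes f: "bounded_clinear f"
  shows "cinner (cadjoint f y) x = cinner y (f x)"
  by (metis cinner_cadjoint[OF f] cinner_commute)

lemma bounded_clinear_cadjoint:
  fixes f :: "'a :: chilbert_space \<Rightarrow> 'b :: chilbert_space"
  assumes f: "bounded_clinear f"
  shows "bounded_clinear (cadjoint f)"
proof -
  have add: "cadjoint f (x + y) = cadjoint f x + cadjoint f y" for x y
    by (rule cinner_eqI) (simp add: cinner_simps cinner_cadjoint[OF f, symmetric])
  have sc: "cadjoint f (c *\<^sub>C x) = c *\<^sub>C cadjoint f x" for c x
    by (rule cinner_eqI) (simp add: cinner_simps cinner_cadjoint[OF f, symmetric])
  obtain K where K: "K \<ge> 0" "\<And>x. norm (f x) \<le> norm x * K"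
    using bounded_linear.nonneg_bounded[OF bounded_clinear_bounded_linear[OF f]] by blast
  \<comment> \<open>Cauchy-Schwarz bounds the square of \<open>norm (cadjoint f y)\<close> by
    \<open>K\<close> times itself times \<open>norm y\<close>; cancelling one factor requires it to
    be nonzero.\<close>
  have "norm (cadjoint f y) \<le> norm y * K" for y
  proof (cases "cadjoint f y = 0")
    case True
    then show ?thesis using K(1) by simp
  next
    case False
    have "(norm (cadjoint f y))\<^sup>2 = Re (cinner (f (cadjoint f y)) y)"
      by (simp add: norm_sq_cinner cinner_cadjoint[OF f])
    also have "\<dots> \<le> norm (f (cadjoint f y)) * norm y"
      using complex_Re_le_cmod cinner_cauchy_schwarz order_trans by blast
    also have "\<dots> \<le> norm (cadjoint f y) * K * norm y" by (intro mult_right_mono K(2)) simp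
    finally show ?thesis using False by (simp add: power2_eq_square mult_ac)
  qed
  then have "bounded_linear (cadjoint f)"
    by (intro bounded_linear_intro[of _ K]) (auto simp: add sc scaleC_of_real[symmetric])
  then show ?thesis by (simp add: bounded_clinear_def sc)
qed

lemma norm_cadjoint_normal:
  assumes "normal_operator f"
  shows "norm (cadjoint f x) = norm (f x)"
proof -
  have f: "bounded_clinear f" and c: "\<And>x. f (cadjoint f x) = cadjoint f (f x)"
    using assms by (auto simp: normal_operator_def o_def fun_eq_iff)
  have "cinner (cadjoint f x) (cadjoint f x) = cinner (f x) (f x)"
    using cinner_cadjoint[OF f, of "cadjoint f x" x] cinner_cadjoint'[OF f, of "f x" x] by (simp add: c)
  then have "(norm (cadjoint f x))\<^sup>2 = (norm (f x))\<^sup>2" by (simp add: norm_sq_cinner)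
  then show ?thesis by simp
qed

section \<open>Bounded functional calculus of a spectral measure\<close>

text \<open>Complex polarization recovers the whole form from its diagonal, so operators can be
  compared through the diagonal values that scalar spectral measures provide.\<close>

lemma clinear_eqI:
  assumes F: "bounded_clinear F" and G: "bounded_clinear G"
    and eq: "\<And>x. cinner (F x) x = cinner (G x) (x :: 'a :: complex_inner)"
  shows "F = G"
proof -
  have "4 * cinner (F x) y = 4 * cinner (G x) y" for x y
    using cinner_polarization[OF bounded_clinearD(1,2)[OF F], of "\<lambda>x. x" x y]
      cinner_polarization[OF bounded_clinearD(1,2)[OF G], of "\<lambda>x. x" x y]
    by (simp only: eq refl)
  then have "cinner y (F x) = cinner y (G x)" for x y
    by (metis cinner_commute mult_left_cancel zero_neq_numeral)
  then show ?thesis by (auto intro: cinner_eqI)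
qed

text \<open>The bounded Borel functional calculus in weak form. As a relation it presupposes no
  construction of the operator, and testing on the diagonal keeps all measures positive.\<close>

definition spectral_integral ::
    "((complex ^ 'n) set \<Rightarrow> 'k :: chilbert_space \<Rightarrow> 'k) \<Rightarrow> (complex ^ 'n \<Rightarrow> complex) \<Rightarrow>
     ('k \<Rightarrow> 'k) \<Rightarrow> bool" where
  "spectral_integral E f F \<longleftrightarrow>
     f \<in> borel_measurable borel \<and> (\<exists>B. \<forall>z. cmod (f z) \<le> B) \<and> bounded_clinear F \<and>
     (\<forall>x. cinner (F x) x = (\<integral>z. f z \<partial>scalar_spectral_measure E x))"

context
  fixes E :: "(complex ^ 'n :: finite) set \<Rightarrow> 'k :: chilbert_space \<Rightarrow> 'k"
  assumes E: "spectral_measure E"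
begin

section \<open>Projections and scalar measures of a spectral measure\<close>

lemma spectral_projection:
  assumes "A \<in> sets borel"
  shows "bounded_clinear (E A)" "cinner (E A x) y = cinner x (E A y)"
  using assms E cinner_cadjoint[of "E A" x y]
  by (auto simp: spectral_measure_def orthogonal_projection_def)

lemma spectral_projection_Int:
  "A \<in> sets borel \<Longrightarrow> B \<in> sets borel \<Longrightarrow> E A (E B x) = E (A \<inter> B) x"
  using E by (simp add: spectral_measure_def)

lemma spectral_projection_UNIV: "E UNIV x = x" and spectral_projection_empty: "E {} x = 0"
  using E by (simp_all add: spectral_measure_def)

lemma cinner_spectral_projection:
  assumes "A \<in> sets borel"
  shows "cinner (E A x) x = of_real ((norm (E A x))\<^sup>2)"
  using spectral_projection(2)[OF assms, of "E A x" x] spectral_projection_Int[OF assms assms, of x]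
  by (simp add: cinner_self)

lemma sets_scalar_spectral_measure [measurable_cong, simp]:
  "sets (scalar_spectral_measure E x) = sets borel"
  using sets.sigma_sets_eq[of "borel :: (complex ^ 'n) measure"]
  by (simp add: scalar_spectral_measure_def sets_measure_of)

lemma space_scalar_spectral_measure [simp]: "space (scalar_spectral_measure E x) = UNIV"
  by (simp add: scalar_spectral_measure_def space_measure_of_conv)

lemma borel_measurable_scalar_spectral_measure:
  "borel_measurable (scalar_spectral_measure E x) = borel_measurable borel"
  by (rule measurable_cong_sets) simp_all

text \<open>Countable additivity, on which the value of \<open>measure_of\<close> depends, comes
  from the strong countable additivity of \<open>E\<close> by pairing with \<open>x\<close>; since
  \<open>E A\<close> is a projection, the value is a squared norm.\<close>

lemma emeasure_scalar_spectral_measure: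
  assumes A: "A \<in> sets borel"
  shows "emeasure (scalar_spectral_measure E x) A = ennreal ((norm (E A x))\<^sup>2)"
proof -
  have "emeasure (scalar_spectral_measure E x) A = ennreal (Re (cinner (E A x) x))"
    unfolding scalar_spectral_measure_def
  proof (rule emeasure_measure_of_sigma[OF _ _ _ A])
    show "sigma_algebra UNIV (sets (borel :: (complex ^ 'n) measure))"
      using sets.sigma_algebra_axioms[of borel] by simp
    show "positive (sets borel) (\<lambda>A. ennreal (Re (cinner (E A x) x)))"
      by (simp add: positive_def spectral_projection_empty)
    show "countably_additive (sets borel) (\<lambda>A. ennreal (Re (cinner (E A x) x)))"
    proof (rule countably_additiveI)
      fix A :: "nat \<Rightarrow> (complex ^ 'n) set"
      assume A: "range A \<subseteq> sets borel" "disjoint_family A"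
      have "(\<lambda>k. E (A k) x) sums E (\<Union>k. A k) x"
        using E A by (simp add: spectral_measure_def)
      then have "(\<lambda>k. Re (cinner (E (A k) x) x)) sums Re (cinner (E (\<Union>k. A k) x) x)"
        by (intro sums_Re bounded_linear.sums[OF bounded_linear_cinner_left])
      then show "(\<Sum>i. ennreal (Re (cinner (E (A i) x) x))) = ennreal (Re (cinner (E (\<Union>(range A)) x) x))"
        using A by (intro suminf_ennreal_eq) (auto simp: cinner_spectral_projection)
    qed
  qed
  then show ?thesis by (simp add: cinner_spectral_projection[OF A])
qed

lemma finite_measure_scalar_spectral_measure: "finite_measure (scalar_spectral_measure E x)"
  by (rule finite_measureI) (simp add: emeasure_scalar_spectral_measure)

lemma integrable_scalar_spectral_measure:
  fixes f :: "complex ^ 'n \<Rightarrow> complex"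
  assumes "f \<in> borel_measurable borel" "\<And>z. cmod (f z) \<le> B"
  shows "integrable (scalar_spectral_measure E x) f"
proof (rule finite_measure.integrable_const_bound[OF finite_measure_scalar_spectral_measure])
  show "AE z in scalar_spectral_measure E x. norm (f z) \<le> B" using assms(2) by simp
  show "f \<in> borel_measurable (scalar_spectral_measure E x)"
    unfolding borel_measurable_scalar_spectral_measure by (rule assms(1))
qed

section \<open>Algebra of the operator integral\<close>

lemma spectral_integral_integrable:
  "spectral_integral E f F \<Longrightarrow> integrable (scalar_spectral_measure E x) f"
  using integrable_scalar_spectral_measure unfolding spectral_integral_def by blast

lemma spectral_integral_indicator:
  assumes A: "A \<in> sets borel"
  shows "spectral_integral E (indicator A) (E A)"
proof -
  have "cinner (E A x) x = (\<integral>z. indicator A z \<partial>scalar_spectral_measure E x)" for x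
  proof -
    have "has_bochner_integral (scalar_spectral_measure E x) (\<lambda>z. indicator A z *\<^sub>R (1 :: complex))
        (measure (scalar_spectral_measure E x) A *\<^sub>R 1)"
      using A by (intro has_bochner_integral_indicator) (simp_all add: emeasure_scalar_spectral_measure)
    moreover have "(\<lambda>z. indicator A z *\<^sub>R (1 :: complex)) = indicator A"
      by (auto simp: indicator_def)
    ultimately have "(\<integral>z. indicator A z \<partial>scalar_spectral_measure E x)
        = complex_of_real (measure (scalar_spectral_measure E x) A)"
      by (simp add: has_bochner_integral_integral_eq scaleR_conv_of_real)
    then show ?thesis
      by (simp add: measure_def emeasure_scalar_spectral_measure[OF A] cinner_spectral_projection[OF A])
  qed
  moreover have "\<exists>B. \<forall>z. cmod (indicator A z) \<le> B" by (intro exI[of _ 1]) (auto simp: indicator_def)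
  ultimately show ?thesis using A spectral_projection(1)[OF A]
    by (auto simp: spectral_integral_def intro!: borel_measurable_indicator)
qed

lemma spectral_integral_add:
  assumes f: "spectral_integral E f F" and g: "spectral_integral E g G"
  shows "spectral_integral E (\<lambda>z. f z + g z) (\<lambda>x. F x + G x)"
proof -
  obtain B C where "\<forall>z. cmod (f z) \<le> B" "\<forall>z. cmod (g z) \<le> C"
    using f g by (auto simp: spectral_integral_def)
  then have "\<forall>z. cmod (f z + g z) \<le> B + C" using norm_triangle_mono by blast
  then show ?thesis
    using f g spectral_integral_integrable[OF f] spectral_integral_integrable[OF g]
    unfolding spectral_integral_def by (auto simp: bounded_clinear_add cinner_add_left)
qed

lemma spectral_integral_scale:
  assumes f: "spectral_integral E f F"
  shows "spectral_integral E (\<lambda>z. c * f z) (\<lambda>x. c *\<^sub>C F x)"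
proof -
  obtain B where "\<forall>z. cmod (f z) \<le> B" using f by (auto simp: spectral_integral_def)
  then have "\<forall>z. cmod (c * f z) \<le> cmod c * B" by (simp add: norm_mult mult_left_mono)
  then show ?thesis
    using f unfolding spectral_integral_def by (auto simp: bounded_clinear_scaleC cinner_scaleC_left)
qed

lemma spectral_integral_sum:
  assumes "finite I" "\<And>i. i \<in> I \<Longrightarrow> spectral_integral E (f i) (F i)"
  shows "spectral_integral E (\<lambda>z. \<Sum>i\<in>I. f i z) (\<lambda>x. \<Sum>i\<in>I. F i x)"
  using assms
proof (induction I rule: finite_induct)
  case empty
  have "spectral_integral E (\<lambda>_. 0) (\<lambda>_. 0)"
    by (auto simp: spectral_integral_def bounded_clinear_zero)
  then show ?case by simp
next
  case (insert i I)
  then show ?case using spectral_integral_add[of "f i" "F i"] by simp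
qed

lemma spectral_integral_cnj:
  assumes f: "spectral_integral E f F"
  shows "spectral_integral E (\<lambda>z. cnj (f z)) (cadjoint F)"
proof -
  have F: "bounded_clinear F" using f by (simp add: spectral_integral_def)
  have "cinner (cadjoint F x) x = cnj (\<integral>z. f z \<partial>scalar_spectral_measure E x)" for x
    using f cinner_cadjoint'[OF F, of x x] cinner_commute[of x "F x"]
    by (simp add: spectral_integral_def)
  then show ?thesis
    using f bounded_clinear_cadjoint[OF F]
      measurable_compose[OF _ borel_measurable_continuous_onI[OF continuous_on_cnj[OF continuous_on_id]]]
    by (auto simp: spectral_integral_def)
qed

lemma spectral_integral_unique:
  assumes "spectral_integral E f F" "spectral_integral E f G"
  shows "F = G"
  using assms by (intro clinear_eqI) (auto simp: spectral_integral_def)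

text \<open>
  Rotating the component of \<open>x\<close> in the complementary range by a unimodular constant does not change the
  scalar measure, so the off-diagonal part of \<open>F\<close> with respect to \<open>E A\<close> vanishes.
\<close>

lemma spectral_integral_times_indicator:
  assumes f: "spectral_integral E f F" and A: "A \<in> sets borel"
  shows "spectral_integral E (\<lambda>z. f z * indicator A z) (F \<circ> E A)"
proof -
  have F: "bounded_clinear F" and Fi: "\<And>x. cinner (F x) x = (\<integral>z. f z \<partial>scalar_spectral_measure E x)"
    and fm: "f \<in> borel_measurable borel"
    using f by (auto simp: spectral_integral_def)
  have "cinner (F (E A x)) x = (\<integral>z. f z * indicator A z \<partial>scalar_spectral_measure E x)" for x
  proof -
    define a b where "a = E A x" and "b = x - a"
    have "scalar_spectral_measure E (a + c *\<^sub>C b) = scalar_spectral_measure E x" if c: "cmod c = 1" for c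
    proof (rule measure_eqI)
      fix B assume "B \<in> sets (scalar_spectral_measure E (a + c *\<^sub>C b))"
      then have B: "B \<in> sets borel" by simp
      note lin = bounded_clinearD[OF spectral_projection(1)[OF B]]
      \<comment> \<open>\<open>E B\<close> commutes with \<open>E A\<close>, so it preserves the
        orthogonality of the two components \<open>a\<close> and \<open>b\<close>.\<close>
      have orth: "cinner (E B a) (E B b) = 0"
        using A B by (simp add: a_def b_def lin spectral_projection(2) spectral_projection_Int
            cinner_diff_right Int_ac)
      have *: "(norm (E B (a + d *\<^sub>C b)))\<^sup>2 = (norm (E B a))\<^sup>2 + (norm (E B b))\<^sup>2" if "cmod d = 1" for d
        using that by (simp add: lin norm_add_sq norm_scaleC cinner_scaleC_right orth)
      show "emeasure (scalar_spectral_measure E (a + c *\<^sub>C b)) B = emeasure (scalar_spectral_measure E x) B"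
        using *[OF c] *[of 1] B by (simp add: emeasure_scalar_spectral_measure scaleC_one b_def)
    qed simp
    then have const: "cinner (F (a + c *\<^sub>C b)) (a + c *\<^sub>C b) = cinner (F x) x" if "cmod c = 1" for c
      using that by (simp add: Fi)
    \<comment> \<open>By \<open>const\<close> the four diagonal terms of the polarization identity
      are equal; their coefficients 1, -1, \<i> and -\<i> add up to 0.\<close>
    have "cinner (F a) b = 0"
      using cinner_polarization[OF bounded_clinearD(1,2)[OF F], of "\<lambda>x. x" a b]
        const[of 1] const[of "-1"] const[of \<i>] const[of "-\<i>"]
      by (simp add: scaleC_one)
    moreover have "x = a + b" by (simp add: b_def)
    ultimately have "cinner (F (E A x)) x = cinner (F a) a"
      by (metis a_def add.right_neutral cinner_add_right)
    also have "\<dots> = (\<integral>z. f z \<partial>scalar_spectral_measure E a)" by (rule Fi)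
    \<comment> \<open>Projecting the vector by \<open>E A\<close> restricts its scalar measure to
      \<open>A\<close>, expressed here as a density.\<close>
    also have "scalar_spectral_measure E a = density (scalar_spectral_measure E x) (\<lambda>z. ennreal (indicator A z))"
    proof (rule measure_eqI)
      fix B assume "B \<in> sets (scalar_spectral_measure E a)"
      then have B: "B \<in> sets borel" by simp
      have "emeasure (density (scalar_spectral_measure E x) (\<lambda>z. ennreal (indicator A z))) B
          = (\<integral>\<^sup>+z. indicator (A \<inter> B) z \<partial>scalar_spectral_measure E x)"
      proof (subst emeasure_density)
        show "(\<lambda>z. ennreal (indicator A z)) \<in> borel_measurable (scalar_spectral_measure E x)"
          unfolding borel_measurable_scalar_spectral_measure using A by simp
        show "B \<in> sets (scalar_spectral_measure E x)" using B by simp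
        show "(\<integral>\<^sup>+z. ennreal (indicator A z) * indicator B z \<partial>scalar_spectral_measure E x)
            = (\<integral>\<^sup>+z. indicator (A \<inter> B) z \<partial>scalar_spectral_measure E x)"
          by (intro nn_integral_cong) (auto split: split_indicator)
      qed
      also have "\<dots> = emeasure (scalar_spectral_measure E x) (A \<inter> B)" using A B by simp
      finally show "emeasure (scalar_spectral_measure E a) B
          = emeasure (density (scalar_spectral_measure E x) (\<lambda>z. ennreal (indicator A z))) B"
        using A B by (simp add: emeasure_scalar_spectral_measure a_def spectral_projection_Int Int_commute)
    qed simp
    also have "(\<integral>z. f z \<partial>density (scalar_spectral_measure E x) (\<lambda>z. ennreal (indicator A z)))
        = (\<integral>z. f z * indicator A z \<partial>scalar_spectral_measure E x)"
      using A fm by (subst integral_density)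
        (auto simp: borel_measurable_scalar_spectral_measure indicator_def
          intro!: Bochner_Integration.integral_cong borel_measurable_indicator)
    finally show ?thesis .
  qed
  moreover have "\<exists>B. \<forall>z. cmod (f z * indicator A z) \<le> B"
  proof -
    obtain B where B: "\<And>z. cmod (f z) \<le> B" using f by (auto simp: spectral_integral_def)
    then have "B \<ge> 0" using norm_ge_zero order_trans by blast
    then show ?thesis using B by (intro exI[of _ B]) (auto simp: indicator_def)
  qed
  ultimately show ?thesis
    using bounded_clinear_compose[OF F spectral_projection(1)[OF A]] fm A
    by (auto simp: spectral_integral_def intro!: borel_measurable_times borel_measurable_indicator)
qed

text \<open>A simple function is a finite combination of indicators of its level sets, so the
  product rule with any \<open>f\<close> follows from
  \<open>spectral_integral_times_indicator\<close> by linearity.\<close>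

lemma spectral_integral_simple:
  fixes g :: "complex ^ 'n \<Rightarrow> complex"
  assumes g: "simple_function borel g"
  obtains G where "spectral_integral E g G"
    "\<And>f F. spectral_integral E f F \<Longrightarrow> spectral_integral E (\<lambda>z. f z * g z) (F \<circ> G)"
proof -
  have fin: "finite (range g)" using g by (simp add: simple_function_def)
  have meas: "g -` {c} \<in> sets borel" if "c \<in> range g" for c
    using g that by (auto simp: simple_function_def)
  have g_eq: "g z = (\<Sum>c\<in>range g. c * indicator (g -` {c}) z)" for z
  proof -
    have "(\<Sum>c\<in>range g. c * indicator (g -` {c}) z) = (\<Sum>c\<in>range g. if c = g z then c else 0)"
      by (intro sum.cong) (auto simp: indicator_def)
    then show ?thesis using fin by simp
  qed
  define G where "G x = (\<Sum>c\<in>range g. c *\<^sub>C E (g -` {c}) x)" for x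
  have "spectral_integral E (\<lambda>z. \<Sum>c\<in>range g. c * indicator (g -` {c}) z) G"
    unfolding G_def
    by (intro spectral_integral_sum fin spectral_integral_scale spectral_integral_indicator meas)
  then have 1: "spectral_integral E g G" by (simp add: g_eq[symmetric])
  have 2: "spectral_integral E (\<lambda>z. f z * g z) (F \<circ> G)" if f: "spectral_integral E f F" for f F
  proof -
    have F: "bounded_clinear F" using f by (simp add: spectral_integral_def)
    have "spectral_integral E (\<lambda>z. \<Sum>c\<in>range g. c * (f z * indicator (g -` {c}) z))
        (\<lambda>x. \<Sum>c\<in>range g. c *\<^sub>C (F \<circ> E (g -` {c})) x)"
      by (intro spectral_integral_sum fin spectral_integral_scale spectral_integral_times_indicator f meas)
    moreover have "(\<Sum>c\<in>range g. c * (f z * indicator (g -` {c}) z)) = f z * g z" for z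
      by (subst g_eq) (simp add: sum_distrib_left mult_ac)
    moreover have "(\<lambda>x. \<Sum>c\<in>range g. c *\<^sub>C (F \<circ> E (g -` {c})) x) = F \<circ> G"
      by (simp add: fun_eq_iff G_def bounded_clinearD[OF F])
    ultimately show ?thesis by simp
  qed
  from 1 2 show ?thesis by (rule that)
qed

text \<open>Bounded simple functions converge pointwise to \<open>g\<close>, and dominated
  convergence makes their operators converge weakly to \<open>G\<close>. Weak convergence is enough
  for the product, since \<open>F\<close> can be moved to the other argument as its adjoint.\<close>

lemma spectral_integral_mult:
  assumes f: "spectral_integral E f F" and g: "spectral_integral E g G"
  shows "spectral_integral E (\<lambda>z. f z * g z) (F \<circ> G)"
proof -
  have F: "bounded_clinear F" and G: "bounded_clinear G"
    and fm: "f \<in> borel_measurable borel" and gm: "g \<in> borel_measurable borel"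
    using f g by (auto simp: spectral_integral_def)
  obtain B C where B: "\<And>z. cmod (f z) \<le> B" and C: "\<And>z. cmod (g z) \<le> C"
    using f g by (auto simp: spectral_integral_def)
  have BC: "B \<ge> 0" "C \<ge> 0" using B C norm_ge_zero order_trans by blast+
  \<comment> \<open>Approximating relative to the base point 0 bounds \<open>s k z\<close> by twice
    the modulus of \<open>g z\<close>, hence uniformly by \<open>2 * C\<close>.\<close>
  obtain s where s: "\<And>k. simple_function borel (s k)" "\<And>z. (\<lambda>k. s k z) \<longlonglongrightarrow> g z"
      "\<And>k z. dist (s k z) 0 \<le> 2 * dist (g z) 0"
    using borel_measurable_implies_sequence_metric[OF gm, of 0] by auto
  have sC: "cmod (s k z) \<le> 2 * C" for k z
    using s(3)[of k z] C[of z] by simp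
  have "\<forall>k. \<exists>Q. spectral_integral E (s k) Q \<and> spectral_integral E (\<lambda>z. f z * s k z) (F \<circ> Q)"
    using spectral_integral_simple[OF s(1)] f by metis
  then obtain Q where Q: "\<And>k. spectral_integral E (s k) (Q k)"
      "\<And>k. spectral_integral E (\<lambda>z. f z * s k z) (F \<circ> Q k)" by metis
  have Ql: "bounded_clinear (Q k)" for k using Q(1) by (simp add: spectral_integral_def)
  have lim: "(\<lambda>k. \<integral>z. h z * s k z \<partial>scalar_spectral_measure E x)
      \<longlonglongrightarrow> (\<integral>z. h z * g z \<partial>scalar_spectral_measure E x)"
    if h: "h \<in> borel_measurable borel" "\<And>z. cmod (h z) \<le> D" for h D x
  proof (rule integral_dominated_convergence[where w = "\<lambda>_. D * (2 * C)"])
    have "D \<ge> 0" using h(2) norm_ge_zero order_trans by blast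
    then show "AE z in scalar_spectral_measure E x. norm (h z * s k z) \<le> D * (2 * C)" for k
      using h(2) sC by (auto simp: norm_mult intro!: mult_mono)
    show "(\<lambda>z. h z * s k z) \<in> borel_measurable (scalar_spectral_measure E x)" for k
      using h(1) borel_measurable_simple_function[OF s(1)]
      by (simp add: borel_measurable_scalar_spectral_measure borel_measurable_times)
    show "(\<lambda>z. h z * g z) \<in> borel_measurable (scalar_spectral_measure E x)"
      using h(1) gm
      by (simp add: borel_measurable_scalar_spectral_measure borel_measurable_times)
    show "integrable (scalar_spectral_measure E x) (\<lambda>_. D * (2 * C))"
      using finite_measure.integrable_const[OF finite_measure_scalar_spectral_measure] .
  qed (intro AE_I2 tendsto_intros s)
  have diag: "(\<lambda>k. cinner (Q k x) x) \<longlonglongrightarrow> cinner (G x) x" for x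
    using lim[of "\<lambda>_. 1" 1 x] Q(1) g by (simp add: spectral_integral_def)
  have weak: "(\<lambda>k. cinner (Q k x) y) \<longlonglongrightarrow> cinner (G x) y" for x y
  proof -
    have pol: "cinner (H x) y =
       (cinner (H (x + y)) (x + y) - cinner (H (x + (-1) *\<^sub>C y)) (x + (-1) *\<^sub>C y)
       + \<i> * cinner (H (x + \<i> *\<^sub>C y)) (x + \<i> *\<^sub>C y)
       - \<i> * cinner (H (x + (-\<i>) *\<^sub>C y)) (x + (-\<i>) *\<^sub>C y)) / 4" if H: "bounded_clinear H" for H
      using cinner_polarization[OF bounded_clinearD(1,2)[OF H], of "\<lambda>x. x" x y]
      by (simp add: eq_divide_eq mult.commute)
    show ?thesis unfolding pol[OF Ql] pol[OF G] by (intro tendsto_intros diag) simp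
  qed
  have "cinner (F (G x)) x = (\<integral>z. f z * g z \<partial>scalar_spectral_measure E x)" for x
  proof (rule LIMSEQ_unique)
    show "(\<lambda>k. \<integral>z. f z * s k z \<partial>scalar_spectral_measure E x)
        \<longlonglongrightarrow> (\<integral>z. f z * g z \<partial>scalar_spectral_measure E x)"
      by (rule lim[OF fm B])
    have "(\<integral>z. f z * s k z \<partial>scalar_spectral_measure E x) = cinner (Q k x) (cadjoint F x)" for k
      using Q(2) by (simp add: spectral_integral_def cinner_cadjoint[OF F, symmetric])
    then show "(\<lambda>k. \<integral>z. f z * s k z \<partial>scalar_spectral_measure E x) \<longlonglongrightarrow> cinner (F (G x)) x"
      using weak by (simp add: cinner_cadjoint[OF F])
  qed
  moreover have "cmod (f z * g z) \<le> B * C" for z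
    using B C BC by (auto simp: norm_mult intro!: mult_mono)
  ultimately show ?thesis
    using bounded_clinear_compose[OF F G] fm gm
    by (auto simp: spectral_integral_def intro!: borel_measurable_times)
qed

lemma spectral_integral_power:
  assumes f: "spectral_integral E f F"
  shows "spectral_integral E (\<lambda>z. f z ^ k) (F ^^ k)"
proof (induction k)
  case 0
  have "spectral_integral E (indicator UNIV) (E UNIV)" by (rule spectral_integral_indicator) simp
  moreover have "E UNIV = id" by (simp add: fun_eq_iff spectral_projection_UNIV)
  moreover have "indicator UNIV = (\<lambda>_. 1 :: complex)" by (auto simp: indicator_def)
  ultimately show ?case by (simp add: id_def)
next
  case (Suc k)
  then show ?case using spectral_integral_mult[OF f Suc] by (simp add: o_def)
qed

end

section \<open>Normal tuples with spectral measure on the boundary of the domain\<close>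

lemma funpow_cadjoint:
  fixes F :: "'a :: chilbert_space \<Rightarrow> 'a"
  assumes F: "bounded_clinear F"
  shows "cinner ((F ^^ k) x) y = cinner x ((cadjoint F ^^ k) y)"
proof (induction k arbitrary: y)
  case (Suc k)
  then show ?case by (simp add: cinner_cadjoint[OF F] funpow_swap1[of "cadjoint F" k y])
qed simp

text \<open>Products of coordinates and their conjugates commute as functions, so the calculus makes
  each \<open>N i\<close> commute with every adjoint (Fuglede's theorem in this setting); the
  equation of the boundary becomes the resolution of the identity.\<close>

lemma joint_spectral_measure_on_boundary:
  fixes N :: "'n :: finite \<Rightarrow> 'k :: chilbert_space \<Rightarrow> 'k"
  assumes p: "admissible_exponents p"
    and N: "\<And>i. bounded_clinear (N i)"
    and sp: "joint_spectral_measure_on N (frontier (Omega p))"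
  shows "N i (cadjoint (N j) x) = cadjoint (N j) (N i x)"
    and "(\<Sum>i\<in>UNIV. \<Sum>j<length (p i). (cadjoint (N i) ^^ (p i ! j)) ((N i ^^ (p i ! j)) x)) = x"
proof -
  define C where "C = frontier (Omega p)"
  obtain E where "joint_spectral_measure N E" and E0: "E (- C) = (\<lambda>_. 0)"
    using sp by (auto simp: joint_spectral_measure_on_def C_def)
  then have E: "spectral_measure E"
    and int: "\<And>i x. has_bochner_integral (scalar_spectral_measure E x) (\<lambda>z. z $ i) (cinner (N i x) x)"
    by (auto simp: joint_spectral_measure_def)
  have C: "C \<in> sets borel" by (simp add: C_def borel_closed)
  have C1: "(\<Sum>i\<in>UNIV. \<Sum>j<length (p i). norm (z $ i) ^ (2 * p i ! j)) = 1" if "z \<in> C" for z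
    using that by (simp add: C_def frontier_Omega[OF p])
  have AE: "AE z in scalar_spectral_measure E x. z \<in> C" for x
  proof (rule AE_I[where N = "- C"])
    show "emeasure (scalar_spectral_measure E x) (- C) = 0"
      using C E0 by (subst emeasure_scalar_spectral_measure[OF E]) auto
  qed (use C E in \<open>auto simp: sets_scalar_spectral_measure\<close>)
  have EC: "E C = id"
  proof -
    have "spectral_integral E (\<lambda>z. indicator C z + indicator (- C) z) (\<lambda>x. E C x + E (- C) x)"
      using C by (intro spectral_integral_add E spectral_integral_indicator) auto
    moreover have "(\<lambda>z. indicator C z + indicator (- C) z) = (indicator UNIV :: _ \<Rightarrow> complex)"
      by (auto simp: indicator_def)
    moreover have "spectral_integral E (indicator UNIV) (E UNIV)"
      by (rule spectral_integral_indicator[OF E]) simp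
    ultimately have "(\<lambda>x. E C x + E (- C) x) = E UNIV"
      using spectral_integral_unique[OF E] by metis
    then show ?thesis using E0 by (simp add: fun_eq_iff spectral_projection_UNIV[OF E])
  qed
  \<comment> \<open>Coordinates are unbounded on the whole space. Cutting them off outside
    \<open>C\<close> brings them into the bounded calculus and changes them only on a null
    set.\<close>
  define f where "f i z = z $ i * indicator C z" for i and z :: "complex ^ 'n"
  \<comment> \<open>The boundary equation has nonnegative terms with total 1, so the first term of
    the list \<open>p i\<close> already rules out a coordinate of modulus above 1.\<close>
  have cnorm: "cmod (z $ i) \<le> 1" if z: "z \<in> C" for z i
  proof (rule ccontr)
    assume "\<not> ?thesis"
    then have gt: "cmod (z $ i) > 1" by simp
    have "length (p i) \<ge> 2" "p i ! 0 > 0"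
      using p by (auto simp: admissible_exponents_def)
        (metis gr_zeroI le_zero_eq length_greater_0_conv list.size(3) nth_mem zero_neq_numeral)
    then have "1 < cmod (z $ i) ^ (2 * p i ! 0)" using gt by (intro one_less_power) auto
    also have "\<dots> \<le> (\<Sum>j<length (p i). norm (z $ i) ^ (2 * p i ! j))"
      using \<open>length (p i) \<ge> 2\<close> by (intro member_le_sum[where f = "\<lambda>j. norm (z $ i) ^ (2 * p i ! j)"]) auto
    also have "\<dots> \<le> (\<Sum>i\<in>UNIV. \<Sum>j<length (p i). norm (z $ i) ^ (2 * p i ! j))"
      by (intro member_le_sum[where f = "\<lambda>i. \<Sum>j<length (p i). norm (z $ i) ^ (2 * p i ! j)"]) (auto intro: sum_nonneg)
    finally show False using C1[OF z] by simp
  qed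
  have fm: "f i \<in> borel_measurable borel" for i
    unfolding f_def using C
    by (intro borel_measurable_times borel_measurable_indicator borel_measurable_continuous_onI
        continuous_intros)
  have f: "spectral_integral E (f i) (N i)" for i
  proof -
    have "cinner (N i x) x = (\<integral>z. f i z \<partial>scalar_spectral_measure E x)" for x
    proof -
      have "cinner (N i x) x = (\<integral>z. z $ i \<partial>scalar_spectral_measure E x)"
        using int[of x i] by (simp add: has_bochner_integral_integral_eq)
      also have "\<dots> = (\<integral>z. f i z \<partial>scalar_spectral_measure E x)"
      proof (rule integral_cong_AE)
        show "(\<lambda>z. z $ i) \<in> borel_measurable (scalar_spectral_measure E x)"
          using int[of x i] by (auto simp: has_bochner_integral_iff)
        show "f i \<in> borel_measurable (scalar_spectral_measure E x)"
          using fm by (simp add: borel_measurable_scalar_spectral_measure[OF E])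
        show "AE z in scalar_spectral_measure E x. z $ i = f i z"
          using AE[of x] by eventually_elim (simp add: f_def)
      qed
      finally show ?thesis .
    qed
    moreover have "cmod (f i z) \<le> 1" for z using cnorm[of z i] by (auto simp: f_def indicator_def)
    ultimately show ?thesis using fm N by (auto simp: spectral_integral_def)
  qed
  have "N i \<circ> cadjoint (N j) = cadjoint (N j) \<circ> N i"
    using spectral_integral_mult[OF E f[of i] spectral_integral_cnj[OF E f[of j]]]
      spectral_integral_mult[OF E spectral_integral_cnj[OF E f[of j]] f[of i]]
    by (intro spectral_integral_unique[OF E, where f = "\<lambda>z. f i z * cnj (f j z)"]) (simp_all add: mult.commute)
  then show "N i (cadjoint (N j) x) = cadjoint (N j) (N i x)" by (simp add: fun_eq_iff)
  have "spectral_integral E (\<lambda>z. \<Sum>i\<in>UNIV. \<Sum>j<length (p i). cnj (f i z) ^ (p i ! j) * f i z ^ (p i ! j))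
     (\<lambda>x. \<Sum>i\<in>UNIV. \<Sum>j<length (p i). ((cadjoint (N i) ^^ (p i ! j)) \<circ> (N i ^^ (p i ! j))) x)"
    by (intro spectral_integral_sum[OF E] spectral_integral_mult[OF E] spectral_integral_power[OF E]
        spectral_integral_cnj[OF E] f) auto
  moreover have "(\<Sum>i\<in>UNIV. \<Sum>j<length (p i). cnj (f i z) ^ (p i ! j) * f i z ^ (p i ! j)) = indicator C z" for z
  proof (cases "z \<in> C")
    case True
    have "cnj w ^ k * w ^ k = of_real (norm w ^ (2 * k))" for w k
      using complex_norm_square[of w]
      by (simp add: power_mult_distrib[symmetric] power_mult mult.commute[of "cnj w"])
    then have "(\<Sum>i\<in>UNIV. \<Sum>j<length (p i). cnj (f i z) ^ (p i ! j) * f i z ^ (p i ! j))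
       = of_real (\<Sum>i\<in>UNIV. \<Sum>j<length (p i). norm (z $ i) ^ (2 * p i ! j))"
      using True by (simp add: f_def)
    then show ?thesis using C1[OF True] True by simp
  next
    case False
    \<comment> \<open>Positivity of the exponents matters here: off \<open>C\<close> the value
      \<open>f i z\<close> is 0, and a zeroth power of it would contribute 1.\<close>
    have "p i ! j > 0" if "j < length (p i)" for i j
      using p nth_mem[OF that] unfolding admissible_exponents_def by blast
    then show ?thesis using False by (auto simp: f_def intro!: sum.neutral)
  qed
  ultimately have "(\<lambda>x. \<Sum>i\<in>UNIV. \<Sum>j<length (p i). ((cadjoint (N i) ^^ (p i ! j)) \<circ> (N i ^^ (p i ! j))) x) = E C"
    using spectral_integral_unique[OF E] spectral_integral_indicator[OF E C] by simp
  then show "(\<Sum>i\<in>UNIV. \<Sum>j<length (p i). (cadjoint (N i) ^^ (p i ! j)) ((N i ^^ (p i ! j)) x)) = x"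
    by (simp add: fun_eq_iff EC)
qed

section \<open>Positivity for spherical isometries\<close>

text \<open>Words index products of operators; counting ordered words rather than multi-indices
  avoids multinomial coefficients.\<close>

definition words :: "'c set \<Rightarrow> nat \<Rightarrow> 'c list set" where
  "words I d = {w. set w \<subseteq> I \<and> length w = d}"

lemma words_0 [simp]: "words I 0 = {[]}"
  by (auto simp: words_def)

lemma finite_words: "finite I \<Longrightarrow> finite (words I d)"
  unfolding words_def by (rule finite_lists_length_eq)

lemma sum_words_Suc:
  "(\<Sum>w\<in>words I (Suc d). f w) = (\<Sum>c\<in>I. \<Sum>w\<in>words I d. f (c # w))"
proof -
  have "words I (Suc d) = (\<lambda>(c, w). c # w) ` (I \<times> words I d)"
    by (auto simp: words_def length_Suc_conv image_iff)
  moreover have "inj_on (\<lambda>(c, w). c # w) (I \<times> words I d)"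
    by (auto simp: inj_on_def)
  ultimately show ?thesis by (simp add: sum.reindex sum.cartesian_product case_prod_unfold)
qed

lemma foldr_commute:
  assumes "\<And>d y. f (V d y) = V d (f y)"
  shows "f (foldr V w x) = foldr V w (f x)"
  by (induction w) (simp_all add: assms)

lemma foldr_intertwine:
  assumes "\<And>c x. f (V c x) = W c (f x)"
  shows "f (foldr V w x) = foldr W w (f x)"
  by (induction w) (simp_all add: assms)

text \<open>The form \<open>q\<close> may be degenerate and differ from the inner product, since it
  will be the defect form of an intertwiner.\<close>

locale spherical_isometry =
  fixes q :: "'h :: ab_group_add \<Rightarrow> 'h \<Rightarrow> complex" and I :: "'c set" and U :: "'c \<Rightarrow> 'h \<Rightarrow> 'h"
  assumes q_add_left: "q (x + y) z = q x z + q y z"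
    and q_commute: "q y x = cnj (q x y)"
    and q_nonneg: "0 \<le> Re (q x x)"
    and finite_index: "finite I"
    and U_add: "U c (x + y) = U c x + U c y"
    and U_commute: "U c (U e x) = U e (U c x)"
    and U_isometry: "(\<Sum>c\<in>I. q (U c x) (U c y)) = q x y"
begin

lemma q_add_right: "q z (x + y) = q z x + q z y"
  by (metis q_add_left q_commute complex_cnj_add)

lemma U_foldr_commute: "U c (foldr U w x) = foldr U w (U c x)"
  by (rule foldr_commute) (rule U_commute)

lemma sum_words_isometry: "(\<Sum>w\<in>words I d. q (foldr U w x) (foldr U w y)) = q x y"
proof (induction d)
  case (Suc d)
  have "(\<Sum>w\<in>words I (Suc d). q (foldr U w x) (foldr U w y))
      = (\<Sum>w\<in>words I d. \<Sum>c\<in>I. q (U c (foldr U w x)) (U c (foldr U w y)))"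
    by (simp add: sum_words_Suc) (rule sum.swap)
  then show ?case by (simp add: U_isometry Suc)
qed simp

text \<open>Makes a positivity statement about single letters available for words of every
  length.\<close>

lemma words_spherical_isometry: "spherical_isometry q (words I d) (foldr U)"
proof
  show "foldr U w (x + y) = foldr U w x + foldr U w y" for w x y
    by (induction w) (simp_all add: U_add)
  show "foldr U w (foldr U v x) = foldr U v (foldr U w x)" for w v x
    by (rule foldr_commute) (rule U_foldr_commute[symmetric])
qed (simp_all add: q_add_left q_commute[symmetric] q_nonneg finite_words finite_index sum_words_isometry)

primrec exchangeable_sum :: "('c \<Rightarrow> 'h) \<Rightarrow> 'c list \<Rightarrow> 'h" where
  "exchangeable_sum Z [] = 0"
| "exchangeable_sum Z (c # w) = U c (exchangeable_sum Z w) + foldr U w (Z c)"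

text \<open>
  On words of length \<open>d\<close>, \<open>exchangeable_sum\<close> is the sum of \<open>d\<close> vectors, the \<open>s\<close>-th of which uses \<open>Z\<close> at
  position \<open>s\<close> and \<open>U\<close> at all others. Any two of them have the same inner product \<open>Q\<close>, and all
  have the same square norm \<open>C\<close>; hence \<open>d C + d (d - 1) Q \<ge> 0\<close> for all \<open>d\<close>.
\<close>

lemma exchangeable_positivity:
  "0 \<le> Re (\<Sum>c\<in>I. \<Sum>e\<in>I. q (U e (Z c)) (U c (Z e)))"
proof -
  define Q where "Q = (\<Sum>c\<in>I. \<Sum>e\<in>I. q (U e (Z c)) (U c (Z e)))"
  define C where "C = (\<Sum>c\<in>I. q (Z c) (Z c))"
  define Y where "Y = exchangeable_sum Z"
  \<comment> \<open>\<open>n d\<close> is the total squared norm of the sum of \<open>d\<close>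
    vectors; \<open>m d\<close> pairs those vectors, shifted by one letter, with the newly added
    one.\<close>
  define m where "m d = (\<Sum>c\<in>I. \<Sum>w\<in>words I d. q (U c (Y w)) (foldr U w (Z c)))" for d
  define n where "n d = (\<Sum>w\<in>words I d. q (Y w) (Y w))" for d
  have zero: "q 0 x = 0" for x using q_add_left[of 0 0 x] by simp
  have U0: "U c 0 = 0" for c using U_add[of c 0 0] by simp
  \<comment> \<open>With the first letter of the word split off, the isometry relation reduces the
    older summands to \<open>m d\<close>, while the newest one contributes exactly
    \<open>Q\<close>.\<close>
  have m: "m d = of_nat d * Q" for d
  proof (induction d)
    case (Suc d)
    have "m (Suc d) = (\<Sum>c\<in>I. \<Sum>e\<in>I. \<Sum>w\<in>words I d.
        q (U e (U c (Y w))) (U e (foldr U w (Z c))) + q (foldr U w (U c (Z e))) (foldr U w (U e (Z c))))"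
      by (simp add: m_def sum_words_Suc Y_def U_add q_add_left U_foldr_commute[symmetric] U_commute)
    also have "\<dots> = (\<Sum>c\<in>I. \<Sum>w\<in>words I d. \<Sum>e\<in>I. q (U e (U c (Y w))) (U e (foldr U w (Z c))))
        + (\<Sum>c\<in>I. \<Sum>e\<in>I. q (U c (Z e)) (U e (Z c)))"
      by (simp add: sum.distrib sum_words_isometry sum.swap[of _ I "words I d"])
    also have "\<dots> = m d + Q"
      by (simp add: U_isometry m_def Q_def) (rule sum.swap)
    finally show ?case by (simp add: Suc algebra_simps)
  qed (simp add: m_def Y_def U0 zero)
  have n: "Re (n d) = real d * Re C + real d * (real d - 1) * Re Q" for d
  proof (induction d)
    case (Suc d)
    have "n (Suc d) = (\<Sum>c\<in>I. \<Sum>w\<in>words I d. q (U c (Y w)) (U c (Y w))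
        + (q (U c (Y w)) (foldr U w (Z c)) + cnj (q (U c (Y w)) (foldr U w (Z c))))
        + q (foldr U w (Z c)) (foldr U w (Z c)))"
      by (simp add: n_def sum_words_Suc Y_def q_add_left q_add_right q_commute[symmetric] add_ac)
    also have "\<dots> = (\<Sum>w\<in>words I d. \<Sum>c\<in>I. q (U c (Y w)) (U c (Y w))) + (m d + cnj (m d)) + C"
      by (simp add: sum.distrib sum_words_isometry C_def m_def sum.swap[of _ "words I d" I])
    also have "\<dots> = n d + (m d + cnj (m d)) + C" by (simp add: U_isometry n_def)
    finally show ?case by (simp add: Suc m algebra_simps)
  qed (simp add: n_def Y_def zero)
  have ge: "0 \<le> real d * (Re C + (real d - 1) * Re Q)" for d
  proof -
    have "0 \<le> Re (n d)" by (simp add: n_def sum_nonneg q_nonneg)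
    then show ?thesis using n[of d] by (simp add: algebra_simps)
  qed
  have "0 \<le> Re Q"
  proof (rule ccontr)
    assume "\<not> ?thesis"
    then have Q: "Re Q < 0" by simp
    \<comment> \<open>For such \<open>k\<close> the quadratic term with negative \<open>Q\<close>
      outweighs \<open>C\<close>; the length used is \<open>Suc k\<close>, for which
      \<open>real d - 1\<close> equals \<open>k\<close>.\<close>
    obtain k where k: "Re C / (- Re Q) < real k" using reals_Archimedean2 by blast
    then have "Re C + real k * Re Q < 0" using Q by (simp add: field_simps)
    then show False using ge[of "Suc k"] by (simp add: zero_le_mult_iff)
  qed
  then show ?thesis by (simp add: Q_def)
qed

end

section \<open>Sums of adjoints applied to a subspace\<close>

text \<open>Applied with the family of adjoints; its values on embedded vectors will be dense in the
  minimal extension.\<close>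

definition adjoint_sum :: "'c set \<Rightarrow> ('c \<Rightarrow> 'k \<Rightarrow> 'k :: complex_inner) \<Rightarrow> nat \<Rightarrow> ('c list \<Rightarrow> 'k) \<Rightarrow> 'k" where
  "adjoint_sum I V d Z = (\<Sum>w\<in>words I d. foldr V w (Z w))"

text \<open>The adjoints form a second family \<open>V'\<close>, so that powers of adjoints can be
  supplied directly. The mixed commutation makes the tuple normal and \<open>resolution\<close>
  makes it spherical.\<close>

locale spherical_unitary =
  fixes I :: "'c set" and V V' :: "'c \<Rightarrow> 'k :: complex_inner \<Rightarrow> 'k"
  assumes fin: "finite I"
    and bounded: "bounded_clinear (V c)" "bounded_clinear (V' c)"
    and adjoint: "cinner (V c x) y = cinner x (V' c y)"
    and commute: "V c (V e x) = V e (V c x)" "V c (V' e x) = V' e (V c x)" "V' c (V' e x) = V' e (V' c x)"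
    and resolution: "(\<Sum>c\<in>I. V' c (V c x)) = x"
begin

lemma isometry: "(\<Sum>c\<in>I. cinner (V c x) (V c y)) = cinner x y"
  by (simp add: adjoint cinner_sum_right[symmetric] resolution)

lemma foldr_linear:
  "foldr V' w (x + y) = foldr V' w x + foldr V' w y"
  "foldr V' w (a *\<^sub>C x) = a *\<^sub>C foldr V' w x"
  "foldr V' w (\<Sum>i\<in>A. h i) = (\<Sum>i\<in>A. foldr V' w (h i))"
  "foldr V' w 0 = 0"
  by (induction w) (simp_all add: bounded_clinearD[OF bounded(2)])

lemma adjoint_foldr: "cinner (foldr V w x) y = cinner x (foldr V' w y)"
proof (induction w arbitrary: y)
  case (Cons c w)
  then show ?case by (simp add: adjoint foldr_commute[of "V' c" V'] commute)
qed simp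

text \<open>As \<open>V\<close> and \<open>V'\<close> commute, each adjoint word can be moved to the
  opposite vector. The resulting double sum has the exchanged indices of
  \<open>exchangeable_positivity\<close>.\<close>

lemma cinner_adjoint_sum:
  "cinner (adjoint_sum I V' d Z) (adjoint_sum I V' d Z)
     = (\<Sum>w\<in>words I d. \<Sum>v\<in>words I d. cinner (foldr V v (Z w)) (foldr V w (Z v)))"
proof -
  have "foldr V v (foldr V' w x) = foldr V' w (foldr V v x)" for v w x
    by (rule foldr_commute) (rule foldr_commute[symmetric], rule commute(2)[symmetric])
  then have "cinner (foldr V' w x) (foldr V' v y) = cinner (foldr V v x) (foldr V w y)" for v w x y
    by (metis adjoint_foldr cinner_commute)
  then show ?thesis
    by (simp only: adjoint_sum_def cinner_sum_left) (simp only: cinner_sum_right)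
qed

text \<open>Inserting \<open>resolution\<close> after each word lengthens it by one letter, so sums
  over words of different lengths can be brought to a common length.\<close>

lemma adjoint_sum_Suc:
  assumes "\<And>c w. Z' (c # w) = V c (Z w)"
  shows "adjoint_sum I V' (Suc d) Z' = adjoint_sum I V' d Z"
proof -
  have "adjoint_sum I V' (Suc d) Z' = (\<Sum>w\<in>words I d. \<Sum>c\<in>I. foldr V' w (V' c (V c (Z w))))"
    by (simp add: adjoint_sum_def sum_words_Suc assms foldr_commute[of "V' _" V'] commute(3))
      (rule sum.swap)
  then show ?thesis by (simp add: adjoint_sum_def foldr_linear(3)[symmetric] resolution)
qed

lemma adjoint_sum_add:
  "adjoint_sum I V' d Z + adjoint_sum I V' d Z' = adjoint_sum I V' d (\<lambda>w. Z w + Z' w)"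
  by (simp add: adjoint_sum_def foldr_linear sum.distrib)

lemma adjoint_sum_scaleC: "a *\<^sub>C adjoint_sum I V' d Z = adjoint_sum I V' d (\<lambda>w. a *\<^sub>C Z w)"
  by (simp add: adjoint_sum_def foldr_linear cvector.scale_sum_right)

lemma adjoint_sum_commute:
  assumes "bounded_clinear f" "\<And>c x. f (V' c x) = V' c (f x)"
  shows "f (adjoint_sum I V' d Z) = adjoint_sum I V' d (\<lambda>w. f (Z w))"
  by (simp add: adjoint_sum_def bounded_clinearD[OF assms(1)] foldr_commute[of f V', OF assms(2)])

text \<open>The new operator becomes the first letter, and vectors set to 0 on all words with
  another first letter remove the remaining terms.\<close>

lemma apply_adjoint_sum:
  assumes "c \<in> I"
  shows "V' c (adjoint_sum I V' d Z) = adjoint_sum I V' (Suc d) (\<lambda>w. if hd w = c then Z (tl w) else 0)"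
proof -
  have "adjoint_sum I V' (Suc d) (\<lambda>w. if hd w = c then Z (tl w) else 0)
      = (\<Sum>e\<in>I. if e = c then V' c (adjoint_sum I V' d Z) else 0)"
    by (auto simp: adjoint_sum_def sum_words_Suc bounded_clinearD[OF bounded(2)] foldr_linear
        intro!: sum.cong)
  then show ?thesis using fin assms by simp
qed

end

lemma cinner_isometry:
  assumes J: "bounded_clinear J" "\<And>x. norm (J x) = norm x"
  shows "cinner (J x) (J y) = cinner x y"
proof -
  have "cinner (J x) (J x) = cinner x x" for x by (simp add: cinner_self J(2))
  then have "4 * cinner (J x) (J y) = 4 * cinner x y"
    using cinner_polarization[OF bounded_clinearD(1,2)[OF J(1)] bounded_clinearD(1,2)[OF J(1)], of x y]
      cinner_polarization[of "\<lambda>x. x" "\<lambda>x. x" x y]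
    by simp
  then show ?thesis by simp
qed

text \<open>The squared right side minus the squared left side is the exchanged double sum over
  words for the defect form of \<open>X\<close>, so the bound is the positivity of that sum.\<close>

lemma norm_adjoint_sum_intertwine:
  fixes S :: "'c \<Rightarrow> 'h :: complex_inner \<Rightarrow> 'h" and T :: "'c \<Rightarrow> 'k :: complex_inner \<Rightarrow> 'k"
  assumes V: "spherical_unitary I V V'" and W: "spherical_unitary I W W'"
    and J: "bounded_clinear J" "\<And>x. norm (J x) = norm x" "\<And>c x. J (S c x) = V c (J x)"
    and L: "bounded_clinear L" "\<And>x. norm (L x) = norm x" "\<And>c x. L (T c x) = W c (L x)"
    and S: "\<And>c. bounded_clinear (S c)" "\<And>c e x. S c (S e x) = S e (S c x)"
    and X: "bounded_clinear X" "\<And>c x. X (S c x) = T c (X x)"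
  shows "norm (adjoint_sum I W' d (\<lambda>w. L (X (Z w)))) \<le> onorm X * norm (adjoint_sum I V' d (\<lambda>w. J (Z w)))"
proof -
  interpret V: spherical_unitary I V V' by (rule V)
  interpret W: spherical_unitary I W W' by (rule W)
  note JJ = cinner_isometry[OF J(1,2)] and LL = cinner_isometry[OF L(1,2)]
  define K where "K = onorm X"
  have K: "norm (X x) \<le> K * norm x" for x
    unfolding K_def by (rule onorm[OF bounded_clinear_bounded_linear[OF X(1)]])
  have K0: "K \<ge> 0" unfolding K_def by (rule onorm_pos_le[OF bounded_clinear_bounded_linear[OF X(1)]])
  \<comment> \<open>Nonnegative because \<open>K\<close> bounds \<open>X\<close>; isometric for
    \<open>S\<close> because \<open>S\<close> is spherical for the inner product and
    \<open>T\<close> is so on the range of \<open>X\<close>.\<close>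
  define q where "q x y = of_real (K\<^sup>2) * cinner x y - cinner (X x) (X y)" for x y
  have "spherical_isometry q I S"
  proof
    show "q (x + y) z = q x z + q y z" for x y z
      by (simp add: q_def bounded_clinearD[OF X(1)] cinner_add_left algebra_simps)
    show "q y x = cnj (q x y)" for x y
      by (simp add: q_def cinner_commute[symmetric])
    show "0 \<le> Re (q x x)" for x
    proof -
      have "(norm (X x))\<^sup>2 \<le> (K * norm x)\<^sup>2" by (intro power_mono K) simp
      then show ?thesis by (simp add: q_def cinner_self power_mult_distrib)
    qed
    have "(\<Sum>c\<in>I. cinner (S c x) (S c y)) = cinner x y" for x y
      using V.isometry[of "J x" "J y"] by (simp add: J(3)[symmetric] JJ)
    moreover have "(\<Sum>c\<in>I. cinner (X (S c x)) (X (S c y))) = cinner (X x) (X y)" for x y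
      using W.isometry[of "L (X x)" "L (X y)"] by (simp add: L(3)[symmetric] LL X(2))
    ultimately show "(\<Sum>c\<in>I. q (S c x) (S c y)) = q x y" for x y
      by (simp add: q_def sum_subtractf sum_distrib_left[symmetric])
  qed (simp_all add: V.fin bounded_clinearD[OF S(1)] S(2))
  then interpret P: spherical_isometry q "words I d" "foldr S"
    by (rule spherical_isometry.words_spherical_isometry)
  define u v where "u = adjoint_sum I V' d (\<lambda>w. J (Z w))" and "v = adjoint_sum I W' d (\<lambda>w. L (X (Z w)))"
  have "cinner u u = (\<Sum>w\<in>words I d. \<Sum>v\<in>words I d. cinner (foldr S v (Z w)) (foldr S w (Z v)))"
    by (simp add: u_def V.cinner_adjoint_sum foldr_intertwine[of J S V, OF J(3), symmetric] JJ)
  moreover have "foldr W w (L (X x)) = L (X (foldr S w x))" for w x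
    using foldr_intertwine[of "\<lambda>x. L (X x)" S W w x] by (simp add: L(3) X(2))
  then have "cinner v v = (\<Sum>w\<in>words I d. \<Sum>v\<in>words I d.
      cinner (X (foldr S v (Z w))) (X (foldr S w (Z v))))"
    by (simp add: v_def W.cinner_adjoint_sum LL)
  ultimately have "(\<Sum>w\<in>words I d. \<Sum>v\<in>words I d. q (foldr S v (Z w)) (foldr S w (Z v)))
      = of_real (K\<^sup>2) * cinner u u - cinner v v"
    by (simp add: q_def sum_subtractf sum_distrib_left)
  then have "0 \<le> Re (of_real (K\<^sup>2) * cinner u u - cinner v v)"
    using P.exchangeable_positivity[of Z] by simp
  then have "(norm v)\<^sup>2 \<le> (K * norm u)\<^sup>2"
    by (simp add: cinner_self power_mult_distrib)
  then have "norm v \<le> K * norm u" by (rule power2_le_imp_le) (simp add: K0)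
  then show ?thesis by (simp add: u_def v_def K_def)
qed

section \<open>Extension by continuity\<close>

text \<open>The map is given by its graph \<open>G\<close>, so well-definedness need not be settled
  in advance: the bound makes the closure of \<open>G\<close> single-valued, and completeness of the
  target with density makes it everywhere defined.\<close>

lemma bounded_clinear_extension:
  fixes G :: "('a :: complex_inner \<times> 'b :: chilbert_space) set"
  assumes add: "\<And>u v u' v'. (u, v) \<in> G \<Longrightarrow> (u', v') \<in> G \<Longrightarrow> (u + u', v + v') \<in> G"
    and scale: "\<And>c u v. (u, v) \<in> G \<Longrightarrow> (c *\<^sub>C u, c *\<^sub>C v) \<in> G"
    and bound: "\<And>u v. (u, v) \<in> G \<Longrightarrow> norm v \<le> K * norm u"
    and dense: "closure (fst ` G) = UNIV"
  obtains F where "bounded_clinear F" "\<And>u. norm (F u) \<le> K * norm u" "\<And>u v. (u, v) \<in> G \<Longrightarrow> F u = v"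
proof -
  have G_diff: "(u - u', v - v') \<in> G" if "(u, v) \<in> G" "(u', v') \<in> G" for u v u' v'
    using add[OF that(1) scale[OF that(2), of "-1"]] by simp
  have cl_add: "(u + u', v + v') \<in> closure G"
    if uv: "(u, v) \<in> closure G" "(u', v') \<in> closure G" for u v u' v'
  proof -
    obtain s t where st: "\<And>n. s n \<in> G" "s \<longlonglongrightarrow> (u, v)" "\<And>n. t n \<in> G" "t \<longlonglongrightarrow> (u', v')"
      using uv unfolding closure_sequential by blast
    have "(\<lambda>n. s n + t n) \<longlonglongrightarrow> (u, v) + (u', v')" by (intro tendsto_add st)
    moreover have "s n + t n \<in> G" for n
      using add[of "fst (s n)" "snd (s n)" "fst (t n)" "snd (t n)"] st by (simp add: plus_prod_def)
    ultimately show ?thesis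
      unfolding closure_sequential by (intro exI[of _ "\<lambda>n. s n + t n"]) simp
  qed
  have cl_scale: "(c *\<^sub>C u, c *\<^sub>C v) \<in> closure G" if uv: "(u, v) \<in> closure G" for u v c
  proof -
    obtain s where s: "\<And>n. s n \<in> G" "s \<longlonglongrightarrow> (u, v)"
      using uv unfolding closure_sequential by blast
    have "(\<lambda>n. (c *\<^sub>C fst (s n), c *\<^sub>C snd (s n))) \<longlonglongrightarrow> (c *\<^sub>C u, c *\<^sub>C v)"
      by (intro tendsto_Pair bounded_linear.tendsto[OF bounded_linear_scaleC])
        (use tendsto_fst[OF s(2)] tendsto_snd[OF s(2)] in simp_all)
    moreover have "(c *\<^sub>C fst (s n), c *\<^sub>C snd (s n)) \<in> G" for n by (intro scale) (simp add: s)
    ultimately show ?thesis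
      unfolding closure_sequential by (intro exI[of _ "\<lambda>n. (c *\<^sub>C fst (s n), c *\<^sub>C snd (s n))"]) simp
  qed
  have cl_bound: "norm v \<le> K * norm u" if uv: "(u, v) \<in> closure G" for u v
  proof -
    obtain s where s: "\<And>n. s n \<in> G" "s \<longlonglongrightarrow> (u, v)"
      using uv unfolding closure_sequential by blast
    have "(\<lambda>n. norm (snd (s n))) \<longlonglongrightarrow> norm v" "(\<lambda>n. K * norm (fst (s n))) \<longlonglongrightarrow> K * norm u"
      using tendsto_fst[OF s(2)] tendsto_snd[OF s(2)] by (auto intro!: tendsto_intros)
    then show ?thesis
      by (rule LIMSEQ_le) (use s(1) bound in \<open>auto intro!: exI[of _ 0] simp: prod_eq_iff\<close>)
  qed
  have ex: "\<exists>v. (u, v) \<in> closure G" for u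
  proof -
    have "u \<in> closure (fst ` G)" using dense by simp
    then obtain r where "\<forall>n. r n \<in> fst ` G" and r: "r \<longlonglongrightarrow> u"
      unfolding closure_sequential by blast
    then have "\<forall>n. \<exists>v. (r n, v) \<in> G" by force
    then obtain t where t: "\<And>n. (r n, t n) \<in> G" by metis
    have "Cauchy t"
    proof (rule metric_CauchyI)
      fix e :: real assume e: "e > 0"
      have "Cauchy r" using r by (rule LIMSEQ_imp_Cauchy)
      \<comment> \<open>\<open>\<bar>K\<bar> + 1\<close> is a positive Lipschitz constant whatever
        the sign of \<open>K\<close>.\<close>
      moreover have "e / (\<bar>K\<bar> + 1) > 0" using e by simp
      ultimately obtain M where M: "\<And>m n. m \<ge> M \<Longrightarrow> n \<ge> M \<Longrightarrow> dist (r m) (r n) < e / (\<bar>K\<bar> + 1)"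
        using metric_CauchyD by blast
      have "dist (t m) (t n) < e" if "m \<ge> M" "n \<ge> M" for m n
      proof -
        have "dist (t m) (t n) \<le> K * norm (r m - r n)"
          using bound[OF G_diff[OF t t]] by (simp add: dist_norm)
        also have "\<dots> \<le> (\<bar>K\<bar> + 1) * dist (r m) (r n)"
          by (simp add: dist_norm mult_right_mono)
        also have "\<dots> < e" using M[OF that] by (simp add: field_simps)
        finally show ?thesis .
      qed
      then show "\<exists>M. \<forall>m\<ge>M. \<forall>n\<ge>M. dist (t m) (t n) < e" by blast
    qed
    then obtain v where "t \<longlonglongrightarrow> v" using Cauchy_convergent convergent_def by blast
    then have "(\<lambda>n. (r n, t n)) \<longlonglongrightarrow> (u, v)" using r by (intro tendsto_Pair)
    then show ?thesis
      using t unfolding closure_sequential by (intro exI[of _ v] exI[of _ "\<lambda>n. (r n, t n)"]) simp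
  qed
  then obtain F where F: "\<And>u. (u, F u) \<in> closure G" by metis
  \<comment> \<open>The difference of the two pairs is \<open>(0, v - w)\<close>, and the bound
    forces its second entry to vanish.\<close>
  have uniq: "v = w" if "(u, v) \<in> closure G" "(u, w) \<in> closure G" for u v w
    using cl_bound[OF cl_add[OF that(1) cl_scale[OF that(2), of "-1"]]] by simp
  have "F (u + v) = F u + F v" "F (c *\<^sub>C u) = c *\<^sub>C F u" for u v c
    by (auto intro: uniq[OF F] cl_add cl_scale F)
  moreover from this have "F (r *\<^sub>R u) = r *\<^sub>R F u" for r u by (metis scaleC_of_real)
  moreover have "norm (F u) \<le> K * norm u" for u by (rule cl_bound[OF F])
  ultimately have "bounded_clinear F"
    unfolding bounded_clinear_def by (auto intro!: bounded_linear_intro[of F K] simp: mult.commute)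
  moreover have "F u = v" if uvG: "(u, v) \<in> G" for u v
    using that closure_subset by (blast intro: uniq F)
  ultimately show ?thesis using that cl_bound[OF F] by blast
qed

section \<open>Reducing subspaces\<close>

text \<open>The least positive difference of elements of \<open>A\<close> divides all differences by
  repeated subtraction, in particular all elements of \<open>B\<close>; hence it is 1.\<close>

lemma coprime_semigroup_consecutive:
  fixes A B :: "nat set"
  assumes zero: "0 \<in> A" and add: "\<And>a b. a \<in> A \<Longrightarrow> b \<in> A \<Longrightarrow> a + b \<in> A"
    and B: "B \<subseteq> A" "Gcd B = 1"
  obtains n where "n \<in> A" "Suc n \<in> A"
proof -
  define D where "D = {d. \<exists>a\<in>A. a + d \<in> A}"
  have D_diff: "d - e \<in> D" if "d \<in> D" "e \<in> D" "e \<le> d" for d e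
  proof -
    obtain a b where "a \<in> A" "a + d \<in> A" "b \<in> A" "b + e \<in> A" using \<open>d \<in> D\<close> \<open>e \<in> D\<close> by (auto simp: D_def)
    then have "a + (b + e) \<in> A" "(a + d) + b \<in> A" using add by blast+
    moreover have "(a + (b + e)) + (d - e) = (a + d) + b" using \<open>e \<le> d\<close> by simp
    ultimately show ?thesis unfolding D_def by (metis (mono_tags, lifting) mem_Collect_eq)
  qed
  have AD: "A \<subseteq> D" using zero by (auto simp: D_def intro!: bexI[of _ 0])
  have "\<exists>b\<in>B. b > 0"
  proof (rule ccontr)
    assume "\<not> ?thesis"
    then have "B \<subseteq> {0}" by auto
    then have "Gcd B = 0" by simp
    then show False using B(2) by simp
  qed
  then have ex: "\<exists>g. g \<in> D \<and> g > 0" using B(1) AD by blast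
  define g where "g = (LEAST g. g \<in> D \<and> g > 0)"
  have g: "g \<in> D" "g > 0" using LeastI_ex[OF ex] by (auto simp: g_def)
  have min: "g \<le> d" if "d \<in> D" "d > 0" for d unfolding g_def by (rule Least_le) (use that in simp)
  have dvd: "g dvd d" if "d \<in> D" for d
    using that
  proof (induction d rule: less_induct)
    case (less d)
    show ?case
    proof (cases "d = 0")
      case False
      then have le: "g \<le> d" using min less.prems by simp
      then have "g dvd d - g" using less.IH[of "d - g"] D_diff[OF less.prems g(1)] False g(2) by simp
      then show ?thesis using le by (simp add: dvd_minus_self)
    qed simp
  qed
  have "g dvd Gcd B" by (rule Gcd_greatest) (use dvd B(1) AD in blast)
  then have "g = 1" using B(2) by simp
  then show ?thesis using g(1) that by (auto simp: D_def)
qed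

text \<open>By normality \<open>cadjoint f (cadjoint f y) = 0\<close> gives
  \<open>f (cadjoint f y) = 0\<close> and thus \<open>cadjoint f y = 0\<close>, which lowers the
  exponent to 1. Exponent 0 stands apart since the zeroth power is the identity.\<close>

lemma cadjoint_funpow_kernel:
  fixes f :: "'a :: chilbert_space \<Rightarrow> 'a"
  assumes f: "normal_operator f" and "(cadjoint f ^^ n) u = 0"
  shows "n = 0 \<or> cadjoint f u = 0"
  using assms(2)
proof (induction n)
  case (Suc n)
  show ?case
  proof (cases n)
    case 0
    then show ?thesis using Suc.prems by simp
  next
    case (Suc k)
    define y where "y = (cadjoint f ^^ k) u"
    have bf: "bounded_clinear f" using f by (simp add: normal_operator_def)
    have "norm (f (cadjoint f y)) = 0"
      using norm_cadjoint_normal[OF f, of "cadjoint f y"] Suc.prems by (simp add: y_def Suc)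
    then have "cinner (cadjoint f y) (cadjoint f y) = 0"
      by (simp add: cinner_cadjoint'[OF bf])
    then show ?thesis using Suc.IH by (simp add: cinner_self_eq_0_iff y_def Suc)
  qed
qed simp

text \<open>
  Let \<open>u\<close> be the component of \<open>f\<^sup>* x\<close> orthogonal to \<open>L\<close>. Since two consecutive powers of \<open>f\<^sup>*\<close> leave
  \<open>L\<close> invariant, \<open>f\<^sup>*\<^sup>n u\<close> lies in \<open>L\<close>; it is also orthogonal to \<open>L\<close>, so \<open>u\<close> is in the kernel of
  a power of \<open>f\<^sup>*\<close>, hence of \<open>f\<close>, and \<open>\<langle>f\<^sup>* x, u\<rangle> = 0\<close>.
\<close>

lemma cadjoint_invariant:
  fixes f :: "'a :: chilbert_space \<Rightarrow> 'a"
  assumes f: "normal_operator f" and L: "cvector.subspace L" "closed L"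
    and inv: "\<And>x. x \<in> L \<Longrightarrow> f x \<in> L"
    and B: "Gcd B = 1" "\<And>n x. n \<in> B \<Longrightarrow> x \<in> L \<Longrightarrow> (cadjoint f ^^ n) x \<in> L"
    and x: "x \<in> L"
  shows "cadjoint f x \<in> L"
proof -
  have bf: "bounded_clinear f" using f by (simp add: normal_operator_def)
  define A where "A = {n. \<forall>x\<in>L. (cadjoint f ^^ n) x \<in> L}"
  obtain n where n: "n \<in> A" "Suc n \<in> A"
  proof (rule coprime_semigroup_consecutive[of A B])
    show "a + b \<in> A" if "a \<in> A" "b \<in> A" for a b
      using that by (simp add: A_def funpow_add)
  qed (use B in \<open>auto simp: A_def\<close>)
  obtain v where v: "v \<in> L" "\<And>l. l \<in> L \<Longrightarrow> cinner (cadjoint f x - v) l = 0"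
    using orthogonal_decomposition[OF L] by blast
  define u where "u = cadjoint f x - v"
  define w where "w = (cadjoint f ^^ n) u"
  have "w = (cadjoint f ^^ Suc n) x - (cadjoint f ^^ n) v"
    by (simp add: w_def u_def bounded_clinearD[OF bounded_clinear_funpow[OF bounded_clinear_cadjoint[OF bf]]]
        funpow_swap1)
  then have wL: "w \<in> L" using n x v(1) csubspaceD(4)[OF L(1)] by (simp add: A_def del: funpow.simps)
  have fL: "(f ^^ k) l \<in> L" if "l \<in> L" for k l
    using that by (induction k) (simp_all add: inv)
  have "cinner w w = cnj (cinner ((f ^^ n) w) u)"
    by (metis cinner_commute funpow_cadjoint[OF bf] w_def)
  also have "\<dots> = cinner u ((f ^^ n) w)" by (simp add: cinner_commute[symmetric])
  also have "\<dots> = 0" using v(2)[OF fL[OF wL]] by (simp add: u_def)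
  finally have "w = 0" by (simp add: cinner_self_eq_0_iff)
  then consider "n = 0" | "cadjoint f u = 0"
    using cadjoint_funpow_kernel[OF f] unfolding w_def by blast
  then show ?thesis
  proof cases
    \<comment> \<open>The consecutive exponents are 0 and 1, and membership of 1 in \<open>A\<close>
      is the claim.\<close>
    case 1
    then show ?thesis using n(2) x by (simp add: A_def)
  next
    case 2
    then have "f u = 0" using norm_cadjoint_normal[OF f, of u] by simp
    then have "cinner (cadjoint f x) u = 0" by (simp add: cinner_cadjoint'[OF bf])
    moreover have "cinner v u = 0"
      using v(2)[OF v(1)] cinner_commute[of v u] by (simp add: u_def)
    ultimately have "cinner u u = 0" by (simp add: u_def cinner_diff_left)
    then have "u = 0" by (simp add: cinner_self_eq_0_iff)
    then show ?thesis using v(1) by (simp add: u_def)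
  qed
qed

lemma csubspace_closure:
  assumes L: "cvector.subspace (L :: 'a :: complex_inner set)"
  shows "cvector.subspace (closure L)"
proof -
  have "0 \<in> closure L" using csubspaceD(1)[OF L] closure_subset by blast
  moreover have "x + y \<in> closure L" if xy: "x \<in> closure L" "y \<in> closure L" for x y
  proof -
    obtain s t where "\<And>n. s n \<in> L" "s \<longlonglongrightarrow> x" "\<And>n. t n \<in> L" "t \<longlonglongrightarrow> y"
      using xy unfolding closure_sequential by metis
    then show ?thesis
      unfolding closure_sequential
      by (intro exI[of _ "\<lambda>n. s n + t n"]) (auto intro: tendsto_add csubspaceD(2)[OF L])
  qed
  moreover have "c *\<^sub>C x \<in> closure L" if x: "x \<in> closure L" for c x
  proof -
    obtain s where "\<And>n. s n \<in> L" "s \<longlonglongrightarrow> x"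
      using x unfolding closure_sequential by blast
    then show ?thesis
      unfolding closure_sequential
      by (intro exI[of _ "\<lambda>n. c *\<^sub>C s n"])
        (auto intro: bounded_linear.tendsto[OF bounded_linear_scaleC] csubspaceD(3)[OF L])
  qed
  ultimately show ?thesis by (auto simp: cvector.subspace_def)
qed

lemma bounded_clinear_closure_invariant:
  assumes f: "bounded_clinear f" and inv: "\<And>x. x \<in> D \<Longrightarrow> f x \<in> D" and x: "x \<in> closure D"
  shows "f x \<in> closure D"
proof -
  obtain s where "\<And>n. s n \<in> D" "s \<longlonglongrightarrow> x"
    using x unfolding closure_sequential by blast
  then show ?thesis
    unfolding closure_sequential
    by (intro exI[of _ "\<lambda>n. f (s n)"])
      (auto intro: inv bounded_clinear_LIMSEQ[OF f])
qed

section \<open>Lifting of intertwiners\<close>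

lemma funpow_commute:
  assumes "\<And>x. f (g x) = g (f x)"
  shows "f ((g ^^ k) x) = (g ^^ k) (f x)"
  by (induction k) (simp_all add: assms)

lemma funpow_commute_funpow:
  assumes "\<And>x. f (g x) = g (f x)"
  shows "(f ^^ l) ((g ^^ k) x) = (g ^^ k) ((f ^^ l) x)"
  by (induction l) (simp_all add: funpow_commute[of f g, OF assms])

lemma funpow_intertwine:
  assumes "\<And>x. f (g x) = h (f x)"
  shows "f ((g ^^ k) x) = (h ^^ k) (f x)"
  by (induction k) (simp_all add: assms)

text \<open>Indexing by positions in the lists counts repeated exponents with multiplicity, as the
  domain does. The mixed commutation comes from the spectral measure.\<close>

lemma spherical_unitary_powers:
  fixes M :: "'n :: finite \<Rightarrow> 'k :: chilbert_space \<Rightarrow> 'k"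
  assumes p: "admissible_exponents p" and M: "commuting_tuple M"
    and sp: "joint_spectral_measure_on M (frontier (Omega p))"
  shows "spherical_unitary (SIGMA i:UNIV. {..<length (p i)})
     (\<lambda>(i, j). M i ^^ (p i ! j)) (\<lambda>(i, j). cadjoint (M i) ^^ (p i ! j))"
proof -
  have b: "bounded_clinear (M i)" for i using M by (simp add: commuting_tuple_def)
  have c1: "M i (M j x) = M j (M i x)" for i j x
    using M by (simp add: commuting_tuple_def fun_eq_iff)
  note c2 = joint_spectral_measure_on_boundary(1)[OF p b sp]
  have c3: "cadjoint (M i) (cadjoint (M j) x) = cadjoint (M j) (cadjoint (M i) x)" for i j x
    by (rule cinner_eqI) (simp add: cinner_cadjoint[OF b, symmetric] c1)
  show ?thesis
  proof
    show "(\<Sum>c\<in>(SIGMA i:UNIV. {..<length (p i)}).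
        (case c of (i, j) \<Rightarrow> cadjoint (M i) ^^ (p i ! j)) ((case c of (i, j) \<Rightarrow> M i ^^ (p i ! j)) x)) = x" for x
      using joint_spectral_measure_on_boundary(2)[OF p b sp, of x]
      by (simp add: sum.Sigma case_prod_unfold)
  qed (auto simp: split_def bounded_clinear_funpow b bounded_clinear_cadjoint funpow_cadjoint
      intro: funpow_commute_funpow c1 c2 c3)
qed

theorem proposition4p6:
  fixes p :: "'n :: finite \<Rightarrow> nat list"
    and S :: "'n \<Rightarrow> 'h :: chilbert_space \<Rightarrow> 'h"
    and T :: "'n \<Rightarrow> 'k :: chilbert_space \<Rightarrow> 'k"
    and J\<^sub>H :: "'h \<Rightarrow> 'hh :: chilbert_space" and M :: "'n \<Rightarrow> 'hh \<Rightarrow> 'hh"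
    and J\<^sub>K :: "'k \<Rightarrow> 'kk :: chilbert_space" and N :: "'n \<Rightarrow> 'kk \<Rightarrow> 'kk"
    and X :: "'h \<Rightarrow> 'k"
  assumes "CARD('n) \<ge> 2"
    and "admissible_exponents p"
    and "separable_infinite_dimensional TYPE('h)"
    and "separable_infinite_dimensional TYPE('k)"
    and "boundary_isometry TYPE('hh) p S"
    and "boundary_isometry TYPE('kk) p T"
    and "minimal_normal_extension S J\<^sub>H M"
    and "minimal_normal_extension T J\<^sub>K N"
    and "bounded_clinear X"
    and "\<forall>i. X \<circ> S i = T i \<circ> X"
  shows "\<exists>X' :: 'hh \<Rightarrow> 'kk.
           bounded_clinear X' \<and>
           (\<forall>x. X' (J\<^sub>H x) = J\<^sub>K (X x)) \<and>
           (\<forall>i. X' \<circ> M i = N i \<circ> X') \<and>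
           onorm X' = onorm X"
proof -
  have spM: "joint_spectral_measure_on M (frontier (Omega p))"
    and spN: "joint_spectral_measure_on N (frontier (Omega p))"
    and S: "commuting_tuple S"
    using assms(5-8) by (auto simp: boundary_isometry_def subnormal_tuple_def)
  have J: "bounded_clinear J\<^sub>H" "\<And>x. norm (J\<^sub>H x) = norm x" "\<And>i x. J\<^sub>H (S i x) = M i (J\<^sub>H x)"
    and M: "commuting_tuple M" "\<And>i. normal_operator (M i)"
    and M_min: "\<And>L. reducing_subspace M L \<Longrightarrow> range J\<^sub>H \<subseteq> L \<Longrightarrow> L = UNIV"
    using assms(7) by (auto simp: minimal_normal_extension_def normal_extension_def)
  have L: "bounded_clinear J\<^sub>K" "\<And>x. norm (J\<^sub>K x) = norm x" "\<And>i x. J\<^sub>K (T i x) = N i (J\<^sub>K x)"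
    and N: "commuting_tuple N"
    using assms(8) by (auto simp: minimal_normal_extension_def normal_extension_def)
  note X = assms(9)
  have XS: "X (S i x) = T i (X x)" for i x using assms(10) by (simp add: fun_eq_iff)
  have bM: "bounded_clinear (M i)" and bN: "bounded_clinear (N i)" and bS: "bounded_clinear (S i)" for i
    using M N S by (simp_all add: commuting_tuple_def)
  have S_comm: "S i (S j x) = S j (S i x)" for i j x
    using S by (simp add: commuting_tuple_def fun_eq_iff)

  \<comment> \<open>The spherical tuples of powers\<close>
  define I where "I = (SIGMA i:UNIV. {..<length (p i)})"
  define V V' where "V = (\<lambda>(i, j). M i ^^ (p i ! j))" and "V' = (\<lambda>(i, j). cadjoint (M i) ^^ (p i ! j))"
  define W W' where "W = (\<lambda>(i, j). N i ^^ (p i ! j))" and "W' = (\<lambda>(i, j). cadjoint (N i) ^^ (p i ! j))"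
  define S' T' where "S' = (\<lambda>(i, j). S i ^^ (p i ! j))" and "T' = (\<lambda>(i, j). T i ^^ (p i ! j))"
  have V: "spherical_unitary I V V'" and W: "spherical_unitary I W W'"
    unfolding I_def V_def V'_def W_def W'_def
    by (rule spherical_unitary_powers[OF assms(2) M(1) spM] spherical_unitary_powers[OF assms(2) N spN])+
  interpret V: spherical_unitary I V V' by (rule V)
  interpret W: spherical_unitary I W W' by (rule W)
  have J': "J\<^sub>H (S' c x) = V c (J\<^sub>H x)" and L': "J\<^sub>K (T' c y) = W c (J\<^sub>K y)"
    and XS': "X (S' c x) = T' c (X x)" for c x y
    unfolding S'_def T'_def V_def W_def split_def
    by (rule funpow_intertwine J L XS)+

  \<comment> \<open>The graph of the lifting on sums of adjoints\<close>
  define D where "D d Z = (adjoint_sum I V' d (\<lambda>w. J\<^sub>H (Z w)), adjoint_sum I W' d (\<lambda>w. J\<^sub>K (X (Z w))))" for d Z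
  define G where "G = {D d Z |d Z. True}"
  \<comment> \<open>The inserted letter is \<open>hd w\<close>; its operator is applied as
    \<open>S'\<close> in the original space, which both embeddings and \<open>X\<close>
    respect.\<close>
  have D_Suc: "D d Z = D (Suc d) (\<lambda>w. S' (hd w) (Z (tl w)))" for d Z
    unfolding D_def
    using V.adjoint_sum_Suc[of "\<lambda>w. J\<^sub>H (S' (hd w) (Z (tl w)))" "\<lambda>w. J\<^sub>H (Z w)" d]
      W.adjoint_sum_Suc[of "\<lambda>w. J\<^sub>K (X (S' (hd w) (Z (tl w))))" "\<lambda>w. J\<^sub>K (X (Z w))" d]
    by (simp add: J' L' XS')
  have D_ge: "\<exists>Z'. D (d + k) Z' = D d Z" for d k Z
  proof (induction k)
    case (Suc k)
    then show ?case using D_Suc by (metis add_Suc_right)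
  qed auto
  have D_add: "D d Z + D d Z' = D d (\<lambda>w. Z w + Z' w)" for d Z Z'
    by (simp add: D_def V.adjoint_sum_add W.adjoint_sum_add bounded_clinearD[OF J(1)]
        bounded_clinearD[OF L(1)] bounded_clinearD[OF X])
  have G_add: "a + b \<in> G" if abG: "a \<in> G" "b \<in> G" for a b
  proof -
    obtain d Z e Z' where ab: "a = D d Z" "b = D e Z'" using abG by (auto simp: G_def)
    \<comment> \<open>Both sums are padded to the common length \<open>d + e\<close>.\<close>
    obtain Y Y' where "D (d + e) Y = a" "D (e + d) Y' = b"
      using D_ge ab by metis
    then have "a + b = D (d + e) (\<lambda>w. Y w + Y' w)" by (metis D_add add.commute)
    then show ?thesis by (auto simp: G_def)
  qed
  have G_scale: "(c *\<^sub>C u, c *\<^sub>C v) \<in> G" if uvG: "(u, v) \<in> G" for c u v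
  proof -
    obtain d Z where "(u, v) = D d Z" using uvG by (auto simp: G_def)
    then have "(c *\<^sub>C u, c *\<^sub>C v) = D d (\<lambda>w. c *\<^sub>C Z w)"
      by (simp add: D_def V.adjoint_sum_scaleC W.adjoint_sum_scaleC bounded_clinearD[OF J(1)]
          bounded_clinearD[OF L(1)] bounded_clinearD[OF X])
    then show ?thesis by (auto simp: G_def)
  qed
  have G_bound: "norm v \<le> onorm X * norm u" if uvG: "(u, v) \<in> G" for u v
  proof -
    obtain d Z where uv: "(u, v) = D d Z" using uvG by (auto simp: G_def)
    have "norm (adjoint_sum I W' d (\<lambda>w. J\<^sub>K (X (Z w)))) \<le> onorm X * norm (adjoint_sum I V' d (\<lambda>w. J\<^sub>H (Z w)))"
    proof (rule norm_adjoint_sum_intertwine[where S = S' and T = T', OF V W])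
      show "bounded_clinear (S' c)" for c by (simp add: S'_def split_def bounded_clinear_funpow bS)
      show "S' c (S' e x) = S' e (S' c x)" for c e x
        unfolding S'_def split_def by (rule funpow_commute_funpow) (rule S_comm)
    qed (rule J(1) J(2) J' L(1) L(2) L' X XS')+
    then show ?thesis using uv by (simp add: D_def)
  qed
  \<comment> \<open>For length 0 the only word is empty and the sum is the vector at that
    word.\<close>
  have G_range: "(J\<^sub>H x, J\<^sub>K (X x)) \<in> G" for x
    unfolding G_def by (auto simp: D_def adjoint_sum_def intro!: exI[of _ 0] exI[of _ "\<lambda>_. x"])
  \<comment> \<open>\<open>M i\<close> commutes with each \<open>V' c\<close> and acts on embedded
    vectors as \<open>S i\<close>; the same holds for \<open>N i\<close>, so both components change
    by replacing \<open>Z w\<close> with \<open>S i (Z w)\<close>.\<close>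
  have G_M: "(M i u, N i v) \<in> G" if uvG: "(u, v) \<in> G" for i u v
  proof -
    obtain d Z where uv: "(u, v) = D d Z" using uvG by (auto simp: G_def)
    have MV: "M i (V' c x) = V' c (M i x)" for c x
      unfolding V'_def split_def
      by (rule funpow_commute) (rule joint_spectral_measure_on_boundary(1)[OF assms(2) bM spM])
    have NW: "N i (W' c x) = W' c (N i x)" for c x
      unfolding W'_def split_def
      by (rule funpow_commute) (rule joint_spectral_measure_on_boundary(1)[OF assms(2) bN spN])
    have "(M i u, N i v) = D d (\<lambda>w. S i (Z w))"
      using uv by (simp add: D_def V.adjoint_sum_commute[OF bM MV] W.adjoint_sum_commute[OF bN NW] J L XS)
    then show ?thesis by (auto simp: G_def)
  qed
  have G_V': "V' c u \<in> fst ` G" if uG: "u \<in> fst ` G" "c \<in> I" for c u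
  proof -
    obtain d Z where u: "u = fst (D d Z)" using uG by (auto simp: G_def)
    have "V' c u = fst (D (Suc d) (\<lambda>w. if hd w = c then Z (tl w) else 0))"
      by (simp add: u D_def V.apply_adjoint_sum[OF uG(2)] if_distrib[of J\<^sub>H] bounded_clinearD[OF J(1)]
          cong: if_cong)
    then show ?thesis by (auto simp: G_def)
  qed

  \<comment> \<open>Density of the sums of adjoints\<close>
  have sub: "cvector.subspace (fst ` G)"
    unfolding cvector.subspace_def
  proof (intro conjI ballI allI)
    show "0 \<in> fst ` G"
      using G_range[of 0] by (force simp: bounded_clinearD[OF J(1)])
    show "x + y \<in> fst ` G" if "x \<in> fst ` G" "y \<in> fst ` G" for x y
      using that G_add by (auto simp: image_iff) (metis fst_conv fst_add)
    show "c *\<^sub>C x \<in> fst ` G" if "x \<in> fst ` G" for c x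
      using that G_scale by (force simp: image_iff)
  qed
  have M_inv: "M i x \<in> closure (fst ` G)" if "x \<in> closure (fst ` G)" for i x
    using that by (rule bounded_clinear_closure_invariant[OF bM, rotated]) (use G_M in force)
  have "reducing_subspace M (closure (fst ` G))"
    unfolding reducing_subspace_def
  proof (intro conjI allI ballI csubspace_closure sub closed_closure M_inv)
    fix i x assume x: "x \<in> closure (fst ` G)"
    \<comment> \<open>The powers of the adjoint with exponents in \<open>p i\<close> are operators
      \<open>V' (i, j)\<close>, which preserve the closure; coprimality carries this over to the
      adjoint itself.\<close>
    show "cadjoint (M i) x \<in> closure (fst ` G)"
    proof (rule cadjoint_invariant[OF M(2) csubspace_closure[OF sub] closed_closure M_inv _ _ x])
      show "Gcd (set (p i)) = 1" using assms(2) by (simp add: admissible_exponents_def)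
      fix n x assume "n \<in> set (p i)" and x: "x \<in> closure (fst ` G)"
      then obtain j where j: "j < length (p i)" "n = p i ! j" by (metis in_set_conv_nth)
      have "(cadjoint (M i) ^^ n) x = V' (i, j) x" by (simp add: V'_def j)
      also have "\<dots> \<in> closure (fst ` G)"
        by (rule bounded_clinear_closure_invariant[OF V.bounded(2) _ x]) (use G_V' j in \<open>auto simp: I_def\<close>)
      finally show "(cadjoint (M i) ^^ n) x \<in> closure (fst ` G)" .
    qed
  qed
  moreover have "range J\<^sub>H \<subseteq> closure (fst ` G)"
  proof
    fix y assume "y \<in> range J\<^sub>H"
    then obtain x where "y = J\<^sub>H x" by blast
    then have "y \<in> fst ` G" using image_eqI[OF _ G_range[of x], of y fst] by simp
    then show "y \<in> closure (fst ` G)" by (rule subsetD[OF closure_subset])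
  qed
  ultimately have dense: "closure (fst ` G) = UNIV" by (rule M_min)

  \<comment> \<open>The lifting, its intertwining relation and its norm\<close>
  have G_add': "(u + u', v + v') \<in> G" if "(u, v) \<in> G" "(u', v') \<in> G" for u v u' v'
    using G_add[OF that] by simp
  obtain F where F: "bounded_clinear F" "\<And>u. norm (F u) \<le> onorm X * norm u"
      "\<And>u v. (u, v) \<in> G \<Longrightarrow> F u = v"
    using bounded_clinear_extension[OF G_add' G_scale G_bound dense] by blast
  have FJ: "F (J\<^sub>H x) = J\<^sub>K (X x)" for x by (rule F(3)[OF G_range])
  \<comment> \<open>Both sides are continuous in \<open>u\<close> and agree on the dense set by
    \<open>G_M\<close>.\<close>
  have "F (M i u) = N i (F u)" for i u
  proof -
    have "u \<in> closure (fst ` G)" by (simp add: dense)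
    then obtain s where s: "\<And>n. s n \<in> fst ` G" "s \<longlonglongrightarrow> u"
      unfolding closure_sequential by blast
    have eq: "F (M i (s n)) = N i (F (s n))" for n
    proof -
      obtain v where "(s n, v) \<in> G" using s(1)[of n] by force
      then show ?thesis using F(3) G_M by metis
    qed
    have "(\<lambda>n. F (M i (s n))) \<longlonglongrightarrow> F (M i u)" "(\<lambda>n. N i (F (s n))) \<longlonglongrightarrow> N i (F u)"
      by (rule bounded_clinear_LIMSEQ[OF F(1) bounded_clinear_LIMSEQ[OF bM s(2)]]
          bounded_clinear_LIMSEQ[OF bN bounded_clinear_LIMSEQ[OF F(1) s(2)]])+
    then show ?thesis unfolding eq by (rule LIMSEQ_unique)
  qed
  moreover have "onorm F = onorm X"
  proof (rule antisym)
    show "onorm F \<le> onorm X"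
      by (rule onorm_bound) (use F(2) onorm_pos_le[OF bounded_clinear_bounded_linear[OF X]] in auto)
    \<comment> \<open>Along the isometric embeddings \<open>F\<close> restricts to \<open>X\<close>,
      so its norm cannot be smaller.\<close>
    show "onorm X \<le> onorm F"
    proof (rule onorm_bound)
      show "norm (X x) \<le> onorm F * norm x" for x
        using onorm[OF bounded_clinear_bounded_linear[OF F(1)], of "J\<^sub>H x"] by (simp add: FJ J(2) L(2))
    qed (rule onorm_pos_le[OF bounded_clinear_bounded_linear[OF F(1)]])
  qed
  ultimately show ?thesis using F(1) FJ by (intro exI[of _ F]) (auto simp: fun_eq_iff)
qed

end
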